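(* Let $\{Z_1(t)\}_{t\ge0}$ be the time-changed compound Poisson process of order $k$, $Z_1(t)=Z(S(t))$, denoted $TCPPoK(\lambda,H,S_{\alpha_1,\alpha_2}^{\mu_1,\mu_2})$, where $S(t)=S_{\alpha_1,\alpha_2}^{\mu_1,\mu_2}(t)$ and $H$ has density $h$. Let $n\ge1$, $0=t_0\le t_1\le\dots\le t_n$, $\Delta t_l=t_l-t_{l-1}$, and $q_j(t)=\mathbb{P}[N^{(k)}(S(t))=j]$ for $j=0,1,2,\ldots$. Then for all real $y_1,\dots,y_n$, $$\mathbb{P}[Z_1(t_1)\le y_1,\dots,Z_1(t_n)\le y_n]=\sum_{j_1,\dots,j_n\ge0}\ \prod_{l=1}^nq_{j_l}(\Delta t_l)\int_{-\infty}^{v_1}\cdots\int_{-\infty}^{v_n}\ \prod_{m=1}^nh^{*j_m}(x_m)\,dx_m,$$ where the sum is over all non-negative integers $j_1,\dots,j_n$, $v_m=y_m-\sum_{l=1}^{m-1}x_l$ for $m=1,\dots,n$ (so the integral is an iterated integral with $x_1$ outermost and $x_n$ innermost), and $h^{*j}$ is the $j$-fold convolution of $h$.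
   Context: Fix an integer $k\ge1$ and $\lambda>0$. Poisson process of order $k$, $PPoK(\lambda)$: $N^{(k)}(t)=\sum_{i=1}^{N(t)}X_i$, where $\{N(t)\}_{t\ge0}$ is a Poisson process with rate $k\lambda$ and $\{X_i\}_{i\ge1}$ are i.i.d. discrete uniform on $\{1,\dots,k\}$, independent of $\{N(t)\}$. Compound Poisson process of order $k$, $CPPoK(\lambda,H)$: $Z(t)=\sum_{i=1}^{N^{(k)}(t)}Y_i$, where $\{N^{(k)}(t)\}_{t\ge0}$ is $PPoK(\lambda)$ and $\{Y_i\}_{i\ge1}$ are i.i.d. real random variables with cumulative distribution function $H$, independent of $\{N^{(k)}(t)\}$ (empty sums are $0$). Mixture of tempered stable subordinators (MTSS): $\{S_{\alpha_1,\alpha_2}^{\mu_1,\mu_2}(t)\}_{t\ge0}$ is the Lévy subordinator (non-decreasing Lévy process started at $0$) with $$\mathbb{E}[e^{-sS_{\alpha_1,\alpha_2}^{\mu_1,\mu_2}(t)}]=\exp\{-t(c_1((s+\mu_1)^{\alpha_1}-\mu_1^{\alpha_1})+c_2((s+\mu_2)^{\alpha_2}-\mu_2^{\alpha_2}))\},\quad s>0,$$ where $c_1,c_2\ge0$, $c_1+c_2=1$, $\mu_1,\mu_2>0$, $\alpha_1,\alpha_2\in(0,1)$. $TCPPoK(\lambda,H,S_{\alpha_1,\alpha_2}^{\mu_1,\mu_2})$: $Z_1(t)=Z(S_{\alpha_1,\alpha_2}^{\mu_1,\mu_2}(t))=\sum_{i=1}^{N^{(k)}(S_{\alpha_1,\alpha_2}^{\mu_1,\mu_2}(t))}Y_i$,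 where $\{Z(t)\}$ (together with $\{N^{(k)}(t)\}$ and $\{Y_i\}$) is independent of $\{S_{\alpha_1,\alpha_2}^{\mu_1,\mu_2}(t)\}$. Convention: $h^{*j}(x)\,dx$ denotes the law of $Y_1+\dots+Y_j$; for $j=0$ it is the Dirac mass at $0$. *)

theory Defs
  imports "HOL-Probability.Probability"
begin

text \<open>
  Processes are functions \<open>real \<Rightarrow> 'a \<Rightarrow> _\<close>, of which only the times \<open>t \<ge> 0\<close> matter;
  sequences of random variables are indexed from 1.  Path properties are required almost surely.
\<close>

text \<open>
  Independence of two random elements, as characterised in \<open>prob_space.indep_var_eq\<close>; the library's
  \<open>prob_space.indep_var\<close> requires both elements to have the same type.  Independence of processes
  is independence of their paths as random elements of the product space.
\<close>

definition indep_elements ::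
  "'a measure \<Rightarrow> 'b measure \<Rightarrow> ('a \<Rightarrow> 'b) \<Rightarrow> 'c measure \<Rightarrow> ('a \<Rightarrow> 'c) \<Rightarrow> bool" where
  "indep_elements M A X B Y \<longleftrightarrow>
     X \<in> measurable M A \<and> Y \<in> measurable M B \<and>
     prob_space.indep_set M (sets (vimage_algebra (space M) X A)) (sets (vimage_algebra (space M) Y B))"

definition independent_increments :: "'a measure \<Rightarrow> (real \<Rightarrow> 'a \<Rightarrow> real) \<Rightarrow> bool" where
  "independent_increments M X \<longleftrightarrow>
     (\<forall>(\<tau> :: nat \<Rightarrow> real) n. 0 \<le> \<tau> 0 \<and> (\<forall>i<n. \<tau> i \<le> \<tau> (Suc i)) \<longrightarrow>
        prob_space.indep_vars M (\<lambda>_. borel) (\<lambda>i \<omega>. X (\<tau> (Suc i)) \<omega> - X (\<tau> i) \<omega>) {..<n})"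

definition levy_process :: "'a measure \<Rightarrow> (real \<Rightarrow> 'a \<Rightarrow> real) \<Rightarrow> bool" where
  "levy_process M X \<longleftrightarrow>
     (\<forall>t\<ge>0. X t \<in> borel_measurable M) \<and>
     (AE \<omega> in M. X 0 \<omega> = 0) \<and>
     independent_increments M X \<and>
     (\<forall>s t. 0 \<le> s \<and> s \<le> t \<longrightarrow>
        distr M borel (\<lambda>\<omega>. X t \<omega> - X s \<omega>) = distr M borel (X (t - s))) \<and>
     (\<forall>s\<ge>0. \<forall>\<epsilon>>0.
        ((\<lambda>t. measure M {\<omega> \<in> space M. \<bar>X t \<omega> - X s \<omega>\<bar> > \<epsilon>}) \<longlongrightarrow> 0) (at s within {0..}))"

definition levy_subordinator :: "'a measure \<Rightarrow> (real \<Rightarrow> 'a \<Rightarrow> real) \<Rightarrow> bool" where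
  "levy_subordinator M S \<longleftrightarrow>
     levy_process M S \<and> (AE \<omega> in M. mono_on {0..} (\<lambda>t. S t \<omega>))"

definition MTSS ::
  "'a measure \<Rightarrow> real \<Rightarrow> real \<Rightarrow> real \<Rightarrow> real \<Rightarrow> real \<Rightarrow> real \<Rightarrow> (real \<Rightarrow> 'a \<Rightarrow> real) \<Rightarrow> bool" where
  "MTSS M c\<^sub>1 c\<^sub>2 \<alpha>\<^sub>1 \<alpha>\<^sub>2 \<mu>\<^sub>1 \<mu>\<^sub>2 S \<longleftrightarrow>
     levy_subordinator M S \<and>
     (\<forall>t\<ge>0. \<forall>s>0. prob_space.expectation M (\<lambda>\<omega>. exp (- s * S t \<omega>)) =
        exp (- t * (c\<^sub>1 * ((s + \<mu>\<^sub>1) powr \<alpha>\<^sub>1 - \<mu>\<^sub>1 powr \<alpha>\<^sub>1) +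
                    c\<^sub>2 * ((s + \<mu>\<^sub>2) powr \<alpha>\<^sub>2 - \<mu>\<^sub>2 powr \<alpha>\<^sub>2))))"

text \<open>
  The strict inequality \<open>s < t\<close> in the law of the increments is there because \<^const>\<open>poisson_pmf\<close>
  is only specified for positive rates.  The subtraction \<open>N t \<omega> - N s \<omega>\<close> on \<^typ>\<open>nat\<close> does not
  truncate, by monotonicity of the paths.
\<close>

definition poisson_process :: "'a measure \<Rightarrow> real \<Rightarrow> (real \<Rightarrow> 'a \<Rightarrow> nat) \<Rightarrow> bool" where
  "poisson_process M r N \<longleftrightarrow>
     (\<forall>t\<ge>0. N t \<in> measurable M (count_space UNIV)) \<and>
     (AE \<omega> in M. N 0 \<omega> = 0 \<and> mono_on {0..} (\<lambda>t. N t \<omega>) \<and>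
        (\<forall>t\<ge>0. continuous (at_right t) (\<lambda>u. N u \<omega>))) \<and>
     independent_increments M (\<lambda>t \<omega>. real (N t \<omega>)) \<and>
     (\<forall>s t. 0 \<le> s \<and> s < t \<longrightarrow>
        distr M (count_space UNIV) (\<lambda>\<omega>. N t \<omega> - N s \<omega>) = measure_pmf (poisson_pmf (r * (t - s))))"

definition PPoK :: "'a measure \<Rightarrow> nat \<Rightarrow> real \<Rightarrow> (real \<Rightarrow> 'a \<Rightarrow> nat) \<Rightarrow> bool" where
  "PPoK M k lam Nk \<longleftrightarrow>
     (\<exists>N (X :: nat \<Rightarrow> 'a \<Rightarrow> nat).
        poisson_process M (real k * lam) N \<and>
        prob_space.indep_vars M (\<lambda>_. count_space UNIV) X {1..} \<and>
        (\<forall>i\<ge>1. distr M (count_space UNIV) (X i) = measure_pmf (pmf_of_set {1..k})) \<and>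
        indep_elements M
          (PiM {0..} (\<lambda>_. count_space UNIV)) (\<lambda>\<omega>. \<lambda>t\<in>{0..}. N t \<omega>)
          (PiM {1..} (\<lambda>_. count_space UNIV)) (\<lambda>\<omega>. \<lambda>i\<in>{1..}. X i \<omega>) \<and>
        (\<forall>t\<ge>0. \<forall>\<omega>\<in>space M. Nk t \<omega> = (\<Sum>i=1..N t \<omega>. X i \<omega>)))"

definition CPPoK ::
  "'a measure \<Rightarrow> nat \<Rightarrow> real \<Rightarrow> (real \<Rightarrow> real) \<Rightarrow>
   (real \<Rightarrow> 'a \<Rightarrow> nat) \<Rightarrow> (nat \<Rightarrow> 'a \<Rightarrow> real) \<Rightarrow> (real \<Rightarrow> 'a \<Rightarrow> real) \<Rightarrow> bool" where
  "CPPoK M k lam H Nk Y Z \<longleftrightarrow>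
     PPoK M k lam Nk \<and>
     prob_space.indep_vars M (\<lambda>_. borel) Y {1..} \<and>
     (\<forall>i\<ge>1. cdf (distr M borel (Y i)) = H) \<and>
     indep_elements M
       (PiM {0..} (\<lambda>_. count_space UNIV)) (\<lambda>\<omega>. \<lambda>t\<in>{0..}. Nk t \<omega>)
       (PiM {1..} (\<lambda>_. borel)) (\<lambda>\<omega>. \<lambda>i\<in>{1..}. Y i \<omega>) \<and>
     (\<forall>t\<ge>0. \<forall>\<omega>\<in>space M. Z t \<omega> = (\<Sum>i=1..Nk t \<omega>. Y i \<omega>))"

text \<open>
  The process \<open>Z\<close> is a measurable function of \<open>(Nk, Y)\<close>, so independence of \<open>(Nk, Y)\<close> and \<open>S\<close>
  is independence of \<open>(Z, Nk, Y)\<close> and \<open>S\<close>.  Since paths are regular only almost surely and \<open>M\<close>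
  need not be complete, that \<open>Nk (S t)\<close> and \<open>Z (S t)\<close> are random variables has to be required;
  it is automatic if the path properties hold everywhere on \<^term>\<open>space M\<close>.
\<close>

definition TCPPoK ::
  "'a measure \<Rightarrow> nat \<Rightarrow> real \<Rightarrow> (real \<Rightarrow> real) \<Rightarrow>
   real \<Rightarrow> real \<Rightarrow> real \<Rightarrow> real \<Rightarrow> real \<Rightarrow> real \<Rightarrow>
   (real \<Rightarrow> 'a \<Rightarrow> nat) \<Rightarrow> (nat \<Rightarrow> 'a \<Rightarrow> real) \<Rightarrow> (real \<Rightarrow> 'a \<Rightarrow> real) \<Rightarrow>
   (real \<Rightarrow> 'a \<Rightarrow> real) \<Rightarrow> (real \<Rightarrow> 'a \<Rightarrow> real) \<Rightarrow> bool" where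
  "TCPPoK M k lam H c\<^sub>1 c\<^sub>2 \<alpha>\<^sub>1 \<alpha>\<^sub>2 \<mu>\<^sub>1 \<mu>\<^sub>2 Nk Y Z S Z1 \<longleftrightarrow>
     CPPoK M k lam H Nk Y Z \<and>
     MTSS M c\<^sub>1 c\<^sub>2 \<alpha>\<^sub>1 \<alpha>\<^sub>2 \<mu>\<^sub>1 \<mu>\<^sub>2 S \<and>
     indep_elements M
       (PiM {0..} (\<lambda>_. count_space UNIV) \<Otimes>\<^sub>M PiM {1..} (\<lambda>_. borel))
       (\<lambda>\<omega>. (\<lambda>t\<in>{0..}. Nk t \<omega>, \<lambda>i\<in>{1..}. Y i \<omega>))
       (PiM {0..} (\<lambda>_. borel)) (\<lambda>\<omega>. \<lambda>t\<in>{0..}. S t \<omega>) \<and>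
     (\<forall>t\<ge>0. \<forall>\<omega>\<in>space M. Z1 t \<omega> = Z (S t \<omega>) \<omega>) \<and>
     (\<forall>t\<ge>0. (\<lambda>\<omega>. Nk (S t \<omega>) \<omega>) \<in> measurable M (count_space UNIV)) \<and>
     (\<forall>t\<ge>0. Z1 t \<in> borel_measurable M)"

definition has_density :: "(real \<Rightarrow> real) \<Rightarrow> (real \<Rightarrow> real) \<Rightarrow> bool" where
  "has_density H h \<longleftrightarrow>
     h \<in> borel_measurable borel \<and> (\<forall>x. 0 \<le> h x) \<and>
     (\<forall>x. set_integrable lborel {..x} h \<and> H x = (LINT u:{..x}|lborel. h u))"

text \<open>
  The convolution powers take values in \<^typ>\<open>ennreal\<close>, as the convolution of two densities may be
  infinite on a null set.  The value at 0 is a dummy: the zeroth power is not a function, but the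
  Dirac mass at 0 in \<open>convolution_law\<close>, which is the measure written \<open>h\<^sup>*\<^sup>j(x) dx\<close>.
\<close>

fun convolution_power :: "(real \<Rightarrow> real) \<Rightarrow> nat \<Rightarrow> real \<Rightarrow> ennreal" where
  "convolution_power h 0 x = 0"
| "convolution_power h (Suc 0) x = ennreal (h x)"
| "convolution_power h (Suc (Suc j)) x =
     (\<integral>\<^sup>+u. convolution_power h (Suc j) (x - u) * ennreal (h u) \<partial>lborel)"

definition convolution_law :: "(real \<Rightarrow> real) \<Rightarrow> nat \<Rightarrow> real measure" where
  "convolution_law h j =
     (if j = 0 then return borel 0 else density lborel (convolution_power h j))"

text \<open>
  \<open>iterated_integral \<nu> y d m x\<close> consists of the \<open>d\<close> inner integrals, over \<open>x\<^sub>m, \<dots>, x\<^sub>m\<^sub>+\<^sub>d\<^sub>-\<^sub>1\<close>, with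
  \<open>x\<^sub>1, \<dots>, x\<^sub>m\<^sub>-\<^sub>1\<close> given by \<open>x\<close>.  With \<open>d = n\<close> and \<open>m = 1\<close> it is the full iterated integral and
  does not depend on \<open>x\<close>.
\<close>

primrec iterated_integral ::
  "(nat \<Rightarrow> real measure) \<Rightarrow> (nat \<Rightarrow> real) \<Rightarrow> nat \<Rightarrow> nat \<Rightarrow> (nat \<Rightarrow> real) \<Rightarrow> real" where
  "iterated_integral \<nu> y 0 m x = 1"
| "iterated_integral \<nu> y (Suc d) m x =
     (LINT u:{..y m - (\<Sum>l\<in>{1..<m}. x l)}|\<nu> m. iterated_integral \<nu> y d (Suc m) (x(m := u)))"

end

theory Submission
  imports Defs
begin

text \<open>
  A process with stationary independent increments keeps them when its time is replaced by an
  independent nondecreasing process with stationary independent increments: freeze the time change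
  by Fubini, use the product formula for the outer increments, and then the independence of the
  increments of the time change.  This is applied twice, to the random walk of the \<open>X\<^sub>i\<close> at Poisson
  times, and to \<open>N\<^sup>(\<^sup>k\<^sup>)\<close> at the times \<open>S(t)\<close>; the sequence \<open>Y\<close> stays independent of the result.
  Given that the increments of \<open>N\<^sup>(\<^sup>k\<^sup>)(S(t\<^sub>l))\<close> are \<open>j\<^sub>1, \<dots>, j\<^sub>n\<close>, the increments of \<open>Z\<^sub>1\<close> are sums of \<open>Y\<close>
  over consecutive disjoint blocks of lengths \<open>j\<^sub>l\<close>, hence independent with laws \<open>h\<^sup>*\<^sup>j\<close>, and the
  iterated integral is the probability that their partial sums stay below \<open>y\<close>.
\<close>

section \<open>Independent random elements\<close>

text \<open>Fixing the vector j first makes the double randomness harmless: once the increments of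
  the counts \<open>Nk (S (t l))\<close> are prescribed, the number of summands in
  \<open>Z1 (t l)\<close> is a constant, and the constraints on \<open>Z1\<close> become an event
  about the sequence \<open>Y\<close> alone. Hence only events of the form "increments equal j, and
  \<open>Y\<close> lies in B" have to be factorised, with B a measurable set of sequences. The sum
  over j is then countable additivity over disjoint events, and no conditional law is formed. Up to
  that point probabilities are \<open>ennreal\<close> values, so that Fubini's theorem asks for
  measurability and nothing else.

  Measurability is the real obstacle. Monotonicity and right continuity of paths hold only almost
  surely, so an event can be exchanged for another one that agrees with it off a null set only after
  both have been shown measurable. After Fubini there are two sample points, one that supplies the
  times and one that supplies the outer process, and the exchange has to be justified separately for
  each way in which they occur.\<close>

lemma emeasure_Collect_cong_AE:
  assumes "AE x in M. P x \<longleftrightarrow> Q x" "{x \<in> space M. P x} \<in> sets M" "{x \<in> space M. Q x} \<in> sets M"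
  shows "emeasure M {x \<in> space M. P x} = emeasure M {x \<in> space M. Q x}"
  using assms by (intro emeasure_eq_AE) auto

lemma sets_Collect_vimage:
  assumes "f \<in> measurable L K" "E \<in> sets K"
  shows "{x \<in> space L. f x \<in> E} \<in> sets L"
proof -
  have "{x \<in> space L. f x \<in> E} = f -` E \<inter> space L" by auto
  then show ?thesis using measurable_sets[OF assms] by simp
qed

text \<open>Increments of counts are written additively throughout, because a difference of natural
  numbers would truncate on paths that are not monotone.\<close>

lemma sets_Collect_eq_add:
  fixes f g :: "'a \<Rightarrow> nat"
  assumes [measurable]: "f \<in> measurable L (count_space UNIV)" "g \<in> measurable L (count_space UNIV)"
  shows "{x \<in> space L. f x = g x + i} \<in> sets L"
proof -
  have "f x = g x + i \<longleftrightarrow> real (f x) = real (g x) + real i" for x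
    by linarith
  moreover have "{x \<in> space L. real (f x) = real (g x) + real i} \<in> sets L"
    by measurable
  ultimately show ?thesis by simp
qed

text \<open>An eventual equation along a sequence is a countable union of countable intersections.
  This keeps right limits along a sequence of times measurable.\<close>

lemma sets_Collect_eventually_eq_add:
  fixes f g :: "nat \<Rightarrow> 'a \<Rightarrow> nat"
  assumes "\<And>m. f m \<in> measurable L (count_space UNIV)" "\<And>m. g m \<in> measurable L (count_space UNIV)"
  shows "{x \<in> space L. \<forall>\<^sub>F m in sequentially. f m x = g m x + i} \<in> sets L"
proof -
  have "{x \<in> space L. \<forall>\<^sub>F m in sequentially. f m x = g m x + i} =
      (\<Union>K. \<Inter>m\<in>{K..}. {x \<in> space L. f m x = g m x + i})"
    by (auto simp: eventually_sequentially)
  also have "\<dots> \<in> sets L"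
    using sets_Collect_eq_add[OF assms]
    by (intro sets.countable_UN sets.countable_INT'') auto
  finally show ?thesis .
qed

lemma (in prob_space) indep_elements_emeasure:
  assumes "indep_elements M A X B Y" and E: "E \<in> sets (A \<Otimes>\<^sub>M B)"
  shows "emeasure M {\<omega> \<in> space M. (X \<omega>, Y \<omega>) \<in> E} =
    (\<integral>\<^sup>+\<omega>. emeasure M {\<omega>' \<in> space M. (X \<omega>', Y \<omega>) \<in> E} \<partial>M)"
proof -
  have X [measurable]: "X \<in> measurable M A" and Y [measurable]: "Y \<in> measurable M B"
    and ind: "indep_set (sets (vimage_algebra (space M) X A)) (sets (vimage_algebra (space M) Y B))"
    using assms(1) unfolding indep_elements_def by auto
  interpret A: prob_space "distr M A X" by (rule prob_space_distr) fact
  interpret B: prob_space "distr M B Y" by (rule prob_space_distr) fact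
  interpret AB: pair_prob_space "distr M A X" "distr M B Y" ..
  have *: "distr M A X \<Otimes>\<^sub>M distr M B Y = distr M (A \<Otimes>\<^sub>M B) (\<lambda>\<omega>. (X \<omega>, Y \<omega>))"
  proof (rule pair_measure_eqI)
    fix a b assume "a \<in> sets (distr M A X)" "b \<in> sets (distr M B Y)"
    then have [measurable]: "a \<in> sets A" "b \<in> sets B" by auto
    have "X -` a \<inter> space M \<in> sets (vimage_algebra (space M) X A)"
      "Y -` b \<inter> space M \<in> sets (vimage_algebra (space M) Y B)"
      by (auto intro: in_vimage_algebra)
    from indep_setD[OF ind this]
    have "emeasure M ((X -` a \<inter> space M) \<inter> (Y -` b \<inter> space M)) =
        emeasure M (X -` a \<inter> space M) * emeasure M (Y -` b \<inter> space M)"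
      by (simp add: emeasure_eq_measure ennreal_mult)
    also have "(X -` a \<inter> space M) \<inter> (Y -` b \<inter> space M) = (\<lambda>\<omega>. (X \<omega>, Y \<omega>)) -` (a \<times> b) \<inter> space M"
      by auto
    finally show "emeasure (distr M A X) a * emeasure (distr M B Y) b =
        emeasure (distr M (A \<Otimes>\<^sub>M B) (\<lambda>\<omega>. (X \<omega>, Y \<omega>))) (a \<times> b)"
      by (simp add: emeasure_distr)
  qed (auto intro: A.sigma_finite_measure_axioms B.sigma_finite_measure_axioms cong: sets_pair_measure_cong)
  have "emeasure M {\<omega> \<in> space M. (X \<omega>, Y \<omega>) \<in> E} =
      emeasure (distr M (A \<Otimes>\<^sub>M B) (\<lambda>\<omega>. (X \<omega>, Y \<omega>))) E"
    using E by (subst emeasure_distr) (auto intro!: arg_cong[where f = "emeasure M"])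
  also have "\<dots> = (\<integral>\<^sup>+y. emeasure (distr M A X) ((\<lambda>x. (x, y)) -` E) \<partial>distr M B Y)"
    unfolding *[symmetric] using E
    by (intro AB.emeasure_pair_measure_alt2) (simp cong: sets_pair_measure_cong)
  also have "\<dots> = (\<integral>\<^sup>+\<omega>. emeasure (distr M A X) ((\<lambda>x. (x, Y \<omega>)) -` E) \<partial>M)"
    using AB.measurable_emeasure_Pair2[of E] E
    by (intro nn_integral_distr) (simp_all cong: sets_pair_measure_cong)
  also have "\<dots> = (\<integral>\<^sup>+\<omega>. emeasure M {\<omega>' \<in> space M. (X \<omega>', Y \<omega>) \<in> E} \<partial>M)"
    using measurable_space[OF Y]
    by (intro nn_integral_cong, subst emeasure_distr)
      (auto intro!: arg_cong[where f = "emeasure M"] sets_Pair2 E)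
  finally show ?thesis .
qed

text \<open>The measurability half of Fubini's theorem for a deterministic parameter
  \<open>y\<close>. With \<open>y\<close> a time, it shows that the probability of an event about a
  path depends measurably on that time.\<close>

lemma (in prob_space) measurable_emeasure_section:
  assumes X: "X \<in> measurable M A" and E: "E \<in> sets (A \<Otimes>\<^sub>M B)"
  shows "(\<lambda>y. emeasure M {\<omega> \<in> space M. (X \<omega>, y) \<in> E}) \<in> borel_measurable B"
proof -
  have "{\<omega> \<in> space M. (X \<omega>, y) \<in> E} = Pair y -` {p \<in> space (B \<Otimes>\<^sub>M M). (X (snd p), fst p) \<in> E}"
    if "y \<in> space B" for y
    using that by (auto simp: space_pair_measure)
  moreover have "{p \<in> space (B \<Otimes>\<^sub>M M). (X (snd p), fst p) \<in> E} \<in> sets (B \<Otimes>\<^sub>M M)"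
    using X E by measurable
  ultimately show ?thesis
    using measurable_emeasure_Pair[of "{p \<in> space (B \<Otimes>\<^sub>M M). (X (snd p), fst p) \<in> E}" B]
    by (simp cong: measurable_cong)
qed

text \<open>The contribution of the time change alone. \<open>T\<close> is real-valued so that the
  Poisson process, embedded by \<open>real\<close>, and the subordinator are both instances;
  \<open>g i\<close> will be the probability of the i-th outer increment as a function of the
  elapsed time.\<close>

lemma (in prob_space) nn_integral_prod_increments:
  assumes rv: "\<And>u. 0 \<le> u \<Longrightarrow> T u \<in> borel_measurable M"
    and ind: "independent_increments M T"
    and stat: "\<And>s u. 0 \<le> s \<Longrightarrow> s \<le> u \<Longrightarrow>
      distr M borel (\<lambda>\<omega>. T u \<omega> - T s \<omega>) = distr M borel (T (u - s))"
    and \<tau>: "0 \<le> \<tau> 0" "\<And>i. i < n \<Longrightarrow> \<tau> i \<le> \<tau> (Suc i)"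
    and g: "\<And>i. i < n \<Longrightarrow> (g i :: real \<Rightarrow> ennreal) \<in> borel_measurable borel"
  shows "(\<integral>\<^sup>+\<omega>. (\<Prod>i<n. g i (T (\<tau> (Suc i)) \<omega> - T (\<tau> i) \<omega>)) \<partial>M) =
    (\<Prod>i<n. \<integral>\<^sup>+\<omega>. g i (T (\<tau> (Suc i) - \<tau> i) \<omega>) \<partial>M)"
proof -
  have nonneg: "0 \<le> \<tau> i" if "i \<le> n" for i
    using that
  proof (induction i)
    case (Suc i)
    then show ?case using \<tau>(2)[of i] by simp
  qed (use \<tau> in simp)
  have "indep_vars (\<lambda>_. borel) (\<lambda>i \<omega>. T (\<tau> (Suc i)) \<omega> - T (\<tau> i) \<omega>) {..<n}"
    using ind \<tau> unfolding independent_increments_def by blast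
  then have "indep_vars (\<lambda>_. borel) (\<lambda>i \<omega>. g i (T (\<tau> (Suc i)) \<omega> - T (\<tau> i) \<omega>)) {..<n}"
    by (rule indep_vars_compose2) (use g in auto)
  then have "(\<integral>\<^sup>+\<omega>. (\<Prod>i<n. g i (T (\<tau> (Suc i)) \<omega> - T (\<tau> i) \<omega>)) \<partial>M) =
      (\<Prod>i<n. \<integral>\<^sup>+\<omega>. g i (T (\<tau> (Suc i)) \<omega> - T (\<tau> i) \<omega>) \<partial>M)"
    by (intro indep_vars_nn_integral) auto
  also have "\<dots> = (\<Prod>i<n. \<integral>\<^sup>+\<omega>. g i (T (\<tau> (Suc i) - \<tau> i) \<omega>) \<partial>M)"
  proof (rule prod.cong)
    fix i assume "i \<in> {..<n}"
    then have i: "i < n" by simp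
    have [measurable]: "T (\<tau> (Suc i)) \<in> borel_measurable M" "T (\<tau> i) \<in> borel_measurable M"
      "T (\<tau> (Suc i) - \<tau> i) \<in> borel_measurable M"
      using i nonneg[of i] nonneg[of "Suc i"] \<tau>(2)[of i] by (auto intro!: rv)
    note [measurable] = g[OF i]
    have "(\<integral>\<^sup>+\<omega>. g i (T (\<tau> (Suc i)) \<omega> - T (\<tau> i) \<omega>) \<partial>M) =
        (\<integral>\<^sup>+x. g i x \<partial>distr M borel (\<lambda>\<omega>. T (\<tau> (Suc i)) \<omega> - T (\<tau> i) \<omega>))"
      by (simp add: nn_integral_distr)
    also have "\<dots> = (\<integral>\<^sup>+x. g i x \<partial>distr M borel (T (\<tau> (Suc i) - \<tau> i)))"
      using i nonneg[of i] \<tau>(2)[of i] by (simp add: stat)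
    also have "\<dots> = (\<integral>\<^sup>+\<omega>. g i (T (\<tau> (Suc i) - \<tau> i) \<omega>) \<partial>M)"
      by (simp add: nn_integral_distr)
    finally show "(\<integral>\<^sup>+\<omega>. g i (T (\<tau> (Suc i)) \<omega> - T (\<tau> i) \<omega>) \<partial>M) =
      (\<integral>\<^sup>+\<omega>. g i (T (\<tau> (Suc i) - \<tau> i) \<omega>) \<partial>M)" .
  qed simp
  finally show ?thesis .
qed

section \<open>Sums of independent identically distributed variables\<close>

text \<open>Convolution powers of measures, where exponent 0 needs no exception. The new factor
  stands on the right, as in the recursion of \<open>convolution_power\<close>.\<close>

fun walk_law :: "real measure \<Rightarrow> nat \<Rightarrow> real measure" where
  "walk_law \<mu> 0 = return borel 0"
| "walk_law \<mu> (Suc j) = convolution (walk_law \<mu> j) \<mu>"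

text \<open>The sums are functions of disjoint subfamilies. Blocks may be empty, which covers
  increments equal to 0.\<close>

lemma (in prob_space) indep_vars_block_sums:
  fixes X :: "'i \<Rightarrow> 'a \<Rightarrow> real"
  assumes "indep_vars (\<lambda>_. borel) X I" and "\<And>l. l \<in> L \<Longrightarrow> K l \<subseteq> I" and "disjoint_family_on K L"
  shows "indep_vars (\<lambda>_. borel) (\<lambda>l \<omega>. \<Sum>i\<in>K l. X i \<omega>) L"
proof -
  have "indep_vars (\<lambda>_. borel) (\<lambda>l \<omega>. \<Sum>i\<in>K l. (restrict (\<lambda>i. X i \<omega>) (K l)) i) L"
    by (rule indep_vars_compose2[OF indep_vars_restrict[OF assms]]) auto
  then show ?thesis by simp
qed

lemma (in prob_space) distr_sum_iid:
  fixes X :: "nat \<Rightarrow> 'a \<Rightarrow> real"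
  assumes ind: "indep_vars (\<lambda>_. borel) X {1..}" and law: "\<And>i. 1 \<le> i \<Longrightarrow> distr M borel (X i) = \<mu>"
  shows "distr M borel (\<lambda>\<omega>. \<Sum>i\<in>{a<..a + d}. X i \<omega>) = walk_law \<mu> d"
proof (induction d)
  case 0
  have "distr M borel (\<lambda>\<omega>. 0::real) = return borel 0"
    by (rule measure_eqI) (auto simp: emeasure_distr emeasure_space_1 indicator_def split: split_indicator)
  then show ?case by simp
next
  case (Suc d)
  have rv: "X i \<in> borel_measurable M" if "1 \<le> i" for i
    using ind that by (auto simp: indep_vars_def)
  have eq: "{a<..a + Suc d} = insert (a + Suc d) {a<..a + d}" by auto
  have "indep_vars (\<lambda>_. borel) X (insert (a + Suc d) {a<..a + d})"
    by (rule indep_vars_subset[OF ind]) auto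
  then have iv: "indep_var borel (X (a + Suc d)) borel (\<lambda>\<omega>. \<Sum>i\<in>{a<..a + d}. X i \<omega>)"
    by (intro indep_vars_sum) auto
  have rvs [measurable]: "(\<lambda>\<omega>. \<Sum>i\<in>{a<..a + d}. X i \<omega>) \<in> borel_measurable M"
    "X (a + Suc d) \<in> borel_measurable M"
    using rv[of "a + Suc d"] by (auto intro!: rv borel_measurable_sum)+
  have "distr M borel (\<lambda>\<omega>. \<Sum>i\<in>{a<..a + Suc d}. X i \<omega>) =
      distr M borel (\<lambda>\<omega>. X (a + Suc d) \<omega> + (\<Sum>i\<in>{a<..a + d}. X i \<omega>))"
    unfolding eq by simp
  also have "\<dots> = convolution \<mu> (walk_law \<mu> d)"
    by (subst sum_indep_random_variable[OF iv]) (simp_all add: Suc law rv)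
  \<comment> \<open>Splitting off the last summand puts its law on the left, whereas
    \<open>walk_law\<close> convolves on the right.\<close>
  also have "\<dots> = convolution (walk_law \<mu> d) \<mu>"
  proof (rule convolution_commutative)
    have "prob_space (distr M borel (X (a + Suc d)))"
      by (rule prob_space_distr) (rule rvs)
    then show "finite_measure \<mu>"
      using law[of "a + Suc d"] by (simp add: prob_space.finite_measure)
    have "sets (distr M borel (X (a + Suc d))) = sets borel" by simp
    then show "sets \<mu> = sets borel"
      using law[of "a + Suc d"] by (simp del: sets_distr)
    have "prob_space (walk_law \<mu> d)"
      unfolding Suc[symmetric] by (rule prob_space_distr) (rule rvs)
    then show "finite_measure (walk_law \<mu> d)"
      by (rule prob_space.finite_measure)
    show "sets (walk_law \<mu> d) = sets borel"
      unfolding Suc[symmetric] by simp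
  qed
  finally show ?case by simp
qed

section \<open>Convolution powers and the law given by a density\<close>

lemma prob_space_walk_law:
  assumes "prob_space \<mu>" "sets \<mu> = sets borel"
  shows "prob_space (walk_law \<mu> j)" and "sets (walk_law \<mu> j) = sets borel"
proof -
  show [measurable_cong, simp]: "sets (walk_law \<mu> j) = sets borel" for j
    by (cases j) auto
  note [measurable_cong, simp] = assms(2)
  show "prob_space (walk_law \<mu> j)"
  proof (induction j)
    case 0
    then show ?case by (simp add: prob_space_return)
  next
    case (Suc j)
    interpret \<mu>: prob_space \<mu> by fact
    interpret W: prob_space "walk_law \<mu> j" by fact
    interpret pair_prob_space "walk_law \<mu> j" \<mu> ..
    show ?case
      unfolding walk_law.simps convolution_def by (rule prob_space_distr) measurable
  qed
qed

text \<open>Bridges the two recursions: \<open>walk_law\<close> starts at exponent 0,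
  \<open>convolution_power\<close> effectively at exponent 1.\<close>

lemma convolution_return:
  assumes "prob_space \<mu>" "sets \<mu> = sets borel"
  shows "convolution (return borel 0) \<mu> = (\<mu> :: real measure)"
proof (rule measure_eqI)
  fix A assume "A \<in> sets (convolution (return borel 0) \<mu>)"
  then have [measurable]: "A \<in> sets borel" by simp
  note [measurable_cong, simp] = assms(2)
  interpret \<mu>: prob_space \<mu> by fact
  interpret r: prob_space "return borel (0::real)" by (rule prob_space_return) simp
  have "emeasure (convolution (return borel 0) \<mu>) A =
      (\<integral>\<^sup>+x. \<integral>\<^sup>+y. indicator A (x + y) \<partial>\<mu> \<partial>return borel 0)"
    by (intro convolution_emeasure') (auto intro: \<mu>.finite_measure r.finite_measure)
  also have "\<dots> = (\<integral>\<^sup>+y. indicator A (0 + y) \<partial>\<mu>)"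
    by (intro nn_integral_return) auto
  also have "\<dots> = emeasure \<mu> A"
    by simp
  finally show "emeasure (convolution (return borel 0) \<mu>) A = emeasure \<mu> A" .
qed (simp add: assms)

lemma borel_measurable_convolution_power [measurable]:
  assumes [measurable]: "h \<in> borel_measurable borel"
  shows "convolution_power h j \<in> borel_measurable borel"
proof -
  have "convolution_power h (Suc j) \<in> borel_measurable borel" for j
  proof (induction j)
    case 0
    have "convolution_power h (Suc 0) = (\<lambda>x. ennreal (h x))" by auto
    then show ?case by simp
  next
    case (Suc j)
    note [measurable] = this
    have "convolution_power h (Suc (Suc j)) =
        (\<lambda>x. \<integral>\<^sup>+u. convolution_power h (Suc j) (x - u) * ennreal (h u) \<partial>lborel)"
      by auto
    then show ?case by simp
  qed
  moreover have "convolution_power h 0 = (\<lambda>_. 0)" by auto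
  ultimately show ?thesis by (cases j) auto
qed

lemma convolution_law_eq_walk_law:
  assumes [measurable]: "h \<in> borel_measurable borel"
    and prob: "prob_space (density lborel (\<lambda>x. ennreal (h x)))"
  shows "convolution_law h j = walk_law (density lborel (\<lambda>x. ennreal (h x))) j"
proof -
  let ?\<mu> = "density lborel (\<lambda>x. ennreal (h x))"
  have W: "prob_space (walk_law ?\<mu> j)" for j
    by (rule prob_space_walk_law) (use prob in auto)
  have "density lborel (convolution_power h (Suc j)) = walk_law ?\<mu> (Suc j)" for j
  proof (induction j)
    case 0
    then show ?case using convolution_return[OF prob] by simp
  next
    case (Suc j)
    have "walk_law ?\<mu> (Suc (Suc j)) =
        convolution (density lborel (convolution_power h (Suc j))) ?\<mu>"
      by (simp only: walk_law.simps(2)[of _ "Suc j"] Suc)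
    also have "\<dots> = density lborel
        (\<lambda>x. \<integral>\<^sup>+u. convolution_power h (Suc j) (x - u) * ennreal (h u) \<partial>lborel)"
      using W[of "Suc j"] prob
      by (intro convolution_density prob_space.finite_measure) (auto simp only: Suc, auto)
    finally show ?case by simp
  qed
  then show ?thesis
    by (cases j) (simp_all add: convolution_law_def)
qed

text \<open>Equality of distribution functions identifies two probability measures, but
  \<open>has_density\<close> speaks of half-lines only. That the density has total mass 1 is
  recovered first, as the limit of the masses of \<open>{..real n}\<close>.\<close>

lemma has_density_law:
  assumes dens: "has_density H h" and \<mu>: "prob_space \<mu>" "sets \<mu> = sets borel" and cdf: "cdf \<mu> = H"
  shows "\<mu> = density lborel (\<lambda>x. ennreal (h x))"
proof -
  have [measurable]: "h \<in> borel_measurable borel" and h: "0 \<le> h x" for x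
    using dens by (auto simp: has_density_def)
  interpret \<mu>: real_distribution \<mu>
    using \<mu> by (intro real_distribution.intro real_distribution_axioms.intro) 
      (auto dest: sets_eq_imp_space_eq)
  let ?D = "density lborel (\<lambda>x. ennreal (h x))"
  have eq: "emeasure ?D {..x} = emeasure \<mu> {..x}" for x
  proof -
    have int: "integrable lborel (\<lambda>u. indicator {..x} u * h u)"
      and H: "H x = (\<integral>u. indicator {..x} u * h u \<partial>lborel)"
      using dens by (auto simp: has_density_def set_integrable_def set_lebesgue_integral_def)
    have "emeasure ?D {..x} = (\<integral>\<^sup>+u. ennreal (indicator {..x} u * h u) \<partial>lborel)"
      by (subst emeasure_density) (auto intro!: nn_integral_cong split: split_indicator)
    also have "\<dots> = ennreal (H x)"
      unfolding H using h by (intro nn_integral_eq_integral int) auto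
    also have "\<dots> = emeasure \<mu> {..x}"
      unfolding cdf[symmetric] cdf_def by (simp add: \<mu>.emeasure_eq_measure)
    finally show ?thesis .
  qed
  have UN: "(\<Union>n. {..real n}) = UNIV"
    using real_arch_simple by auto
  have "emeasure ?D UNIV = (SUP n. emeasure ?D {..real n})"
    by (subst SUP_emeasure_incseq) (auto simp: UN incseq_def)
  also have "\<dots> = (SUP n. emeasure \<mu> {..real n})"
    by (simp only: eq)
  also have "\<dots> = emeasure \<mu> UNIV"
    by (subst SUP_emeasure_incseq) (auto simp: UN incseq_def)
  also have "\<dots> = 1"
    using \<mu>.emeasure_space_1 by simp
  finally interpret D: prob_space ?D
    by (intro prob_spaceI) simp
  interpret D: real_distribution ?D
    by unfold_locales auto
  show ?thesis
    using eq by (intro cdf_unique) (auto simp: cdf_def measure_def intro!: \<mu>.real_distribution_axioms D.real_distribution_axioms)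
qed

section \<open>The iterated integral as a probability\<close>

lemma iterated_integral_eq_measure:
  assumes prob: "\<And>m. prob_space (\<nu> m)" and sets: "\<And>m. sets (\<nu> m) = sets borel" and "1 \<le> m"
  shows "iterated_integral \<nu> y d m x = measure (PiM {m..<m + d} \<nu>)
    {z \<in> space (PiM {m..<m + d} \<nu>).
      \<forall>l\<in>{m..<m + d}. (\<Sum>i\<in>{1..<m}. x i) + (\<Sum>i\<in>{m..l}. z i) \<le> y l}"
  using \<open>1 \<le> m\<close>
proof (induction d arbitrary: m x)
  case 0
  interpret P: prob_space "PiM {m..<m} \<nu>"
    by (intro prob_space_PiM prob)
  show ?case using P.prob_space by simp
next
  case (Suc d)
  note [measurable_cong, simp] = sets
  interpret P: product_prob_space \<nu> I for I
    using prob by (simp add: product_prob_space_def product_sigma_finite_def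
      prob_space_imp_sigma_finite product_prob_space_axioms_def)
  define I where "I = {Suc m..<Suc m + d}"
  have I: "finite I" "m \<notin> I" and ins: "{m..<m + Suc d} = insert m I"
    by (auto simp: I_def)
  define c where "c = (\<Sum>i\<in>{1..<m}. x i)"
  define E where "E = {z \<in> space (PiM (insert m I) \<nu>).
      \<forall>l\<in>insert m I. c + (\<Sum>i\<in>{m..l}. z i) \<le> y l}"
  define F where "F u = {z \<in> space (PiM I \<nu>).
      \<forall>l\<in>I. (c + u) + (\<Sum>i\<in>{Suc m..l}. z i) \<le> y l}" for u
  have sub: "i \<in> insert m I" if "l \<in> insert m I" "i \<in> {m..l}" for l i
    using that by (auto simp: I_def)
  have sub': "i \<in> I" if "l \<in> I" "i \<in> {Suc m..l}" for l i
    using that by (auto simp: I_def)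
  have meas_sum [measurable]: "(\<lambda>z. \<Sum>i\<in>{m..l}. z i) \<in> borel_measurable (PiM (insert m I) \<nu>)"
    if "l \<in> insert m I" for l
    using sub[OF that] by (intro borel_measurable_sum) measurable
  have meas_sum' [measurable]: "(\<lambda>z. \<Sum>i\<in>{Suc m..l}. z i) \<in> borel_measurable (PiM I \<nu>)"
    if "l \<in> I" for l
    using sub'[OF that] by (intro borel_measurable_sum) measurable
  have [measurable]: "E \<in> sets (PiM (insert m I) \<nu>)"
    unfolding E_def using I by measurable
  have [measurable]: "F u \<in> sets (PiM I \<nu>)" for u
    unfolding F_def using I by measurable
  have spm: "space (\<nu> i) = UNIV" for i
    using sets_eq_imp_space_eq[OF sets] by simp
  have IH: "iterated_integral \<nu> y d (Suc m) (x(m := u)) = measure (PiM I \<nu>) (F u)" for u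
  proof -
    have "{1..<Suc m} = insert m {1..<m}" using Suc.prems by auto
    then have "(\<Sum>i\<in>{1..<Suc m}. (x(m := u)) i) = c + u"
      by (simp add: c_def)
    then show ?thesis
      using Suc.IH[of "Suc m" "x(m := u)"] by (simp add: F_def I_def del: fun_upd_apply)
  qed
  have sum_snd: "(\<lambda>p. \<Sum>i\<in>{Suc m..l}. snd p i) \<in> borel_measurable (borel \<Otimes>\<^sub>M PiM I \<nu>)"
    if "l \<in> I" for l
    by (rule measurable_compose[OF measurable_snd meas_sum'[OF that]])
  \<comment> \<open>Joint measurability in \<open>u\<close> and \<open>z\<close>, so that the mass
    of the section \<open>F u\<close> is a Borel function of \<open>u\<close>.\<close>
  have "{p \<in> space (borel \<Otimes>\<^sub>M PiM I \<nu>).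
      \<forall>l\<in>I. (c + fst p) + (\<Sum>i\<in>{Suc m..l}. snd p i) \<le> y l} \<in> sets (borel \<Otimes>\<^sub>M PiM I \<nu>)"
    using I by (intro sets.sets_Collect_finite_All borel_measurable_le borel_measurable_add sum_snd
      borel_measurable_const measurable_fst)
  then have "(\<lambda>u. emeasure (PiM I \<nu>) (Pair u -` {p \<in> space (borel \<Otimes>\<^sub>M PiM I \<nu>).
      \<forall>l\<in>I. (c + fst p) + (\<Sum>i\<in>{Suc m..l}. snd p i) \<le> y l})) \<in> borel_measurable borel"
    by (rule P.P.measurable_emeasure_Pair)
  moreover have "Pair u -` {p \<in> space (borel \<Otimes>\<^sub>M PiM I \<nu>).
      \<forall>l\<in>I. (c + fst p) + (\<Sum>i\<in>{Suc m..l}. snd p i) \<le> y l} = F u" for u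
    by (auto simp: F_def space_pair_measure)
  ultimately have emF [measurable]: "(\<lambda>u. emeasure (PiM I \<nu>) (F u)) \<in> borel_measurable borel"
    by simp
  then have meF [measurable]: "(\<lambda>u. measure (PiM I \<nu>) (F u)) \<in> borel_measurable borel"
    by (simp add: measure_def)
  \<comment> \<open>The constraint with index \<open>m\<close> becomes the range of the outer
    integral; the others form the inner event, whose offset has grown from \<open>c\<close> to
    \<open>c + u\<close>.\<close>
  have E_iff: "z(m := u) \<in> E \<longleftrightarrow> u \<le> y m - c \<and> z \<in> F u" if "z \<in> space (PiM I \<nu>)" for u z
  proof -
    have "(\<Sum>i\<in>{m..l}. (z(m := u)) i) = u + (\<Sum>i\<in>{Suc m..l}. z i)" if "l \<in> I" for l
    proof -
      have "{m..l} = insert m {Suc m..l}" using that by (auto simp: I_def)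
      moreover have "(\<Sum>i\<in>{Suc m..l}. (z(m := u)) i) = (\<Sum>i\<in>{Suc m..l}. z i)"
        by (intro sum.cong) auto
      ultimately show ?thesis by simp
    qed
    moreover have "z(m := u) \<in> space (PiM (insert m I) \<nu>)"
      using that by (auto simp: space_PiM spm PiE_def extensional_def)
    ultimately show ?thesis
      using that by (auto simp: E_def F_def algebra_simps)
  qed
  have "emeasure (PiM (insert m I) \<nu>) E = (\<integral>\<^sup>+u. \<integral>\<^sup>+z. indicator E (z(m := u)) \<partial>PiM I \<nu> \<partial>\<nu> m)"
    using I by (subst P.product_nn_integral_insert_rev[symmetric]) auto
  also have "\<dots> = (\<integral>\<^sup>+u. ennreal (indicator {..y m - c} u * measure (PiM I \<nu>) (F u)) \<partial>\<nu> m)"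
  proof (rule nn_integral_cong)
    fix u
    have "(\<integral>\<^sup>+z. indicator E (z(m := u)) \<partial>PiM I \<nu>) =
        (\<integral>\<^sup>+z. indicator {..y m - c} u * indicator (F u) z \<partial>PiM I \<nu>)"
      by (intro nn_integral_cong) (auto simp: E_iff split: split_indicator)
    also have "\<dots> = ennreal (indicator {..y m - c} u * measure (PiM I \<nu>) (F u))"
      by (subst nn_integral_cmult) (auto simp: P.P.emeasure_eq_measure split: split_indicator)
    finally show "(\<integral>\<^sup>+z. indicator E (z(m := u)) \<partial>PiM I \<nu>) =
        ennreal (indicator {..y m - c} u * measure (PiM I \<nu>) (F u))" .
  qed
  finally have "measure (PiM (insert m I) \<nu>) E =
      enn2real (\<integral>\<^sup>+u. ennreal (indicator {..y m - c} u * measure (PiM I \<nu>) (F u)) \<partial>\<nu> m)"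
    by (simp add: measure_def)
  also have "\<dots> = (\<integral>u. indicator {..y m - c} u * measure (PiM I \<nu>) (F u) \<partial>\<nu> m)"
    by (subst integral_eq_nn_integral) auto
  also have "\<dots> = iterated_integral \<nu> y (Suc d) m x"
    by (simp add: IH set_lebesgue_integral_def c_def)
  finally show ?case
    unfolding ins E_def c_def by simp
qed

section \<open>The Poisson process of order k\<close>

text \<open>The definition gives the law of an increment on \<open>nat\<close> and for
  \<open>s < u\<close>. The increment from 0 to \<open>u - s\<close> has the same law, which settles
  that case without computing with Poisson probabilities; for \<open>s = u\<close> both sides vanish
  almost surely.\<close>

lemma (in prob_space) poisson_process_increments:
  assumes N: "poisson_process M r N" and "0 \<le> s" "s \<le> u"
  shows "distr M borel (\<lambda>\<omega>. real (N u \<omega>) - real (N s \<omega>)) = distr M borel (\<lambda>\<omega>. real (N (u - s) \<omega>))"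
proof -
  have rv: "N t \<in> measurable M (count_space UNIV)" if "0 \<le> t" for t
    using N that by (auto simp: poisson_process_def)
  have [measurable]: "N u \<in> measurable M (count_space UNIV)" "N s \<in> measurable M (count_space UNIV)"
    "N (u - s) \<in> measurable M (count_space UNIV)" "N 0 \<in> measurable M (count_space UNIV)"
    using assms(2,3) by (auto intro!: rv)
  have ae: "AE \<omega> in M. N 0 \<omega> = 0 \<and> N s \<omega> \<le> N u \<omega>"
  proof -
    have "AE \<omega> in M. N 0 \<omega> = 0 \<and> mono_on {0..} (\<lambda>t. N t \<omega>)"
      using N by (auto simp: poisson_process_def)
    then show ?thesis
      by eventually_elim (use assms(2,3) in \<open>auto simp: mono_on_def\<close>)
  qed
  show ?thesis
  proof (cases "s = u")
    case True
    have "AE \<omega> in M. real (N u \<omega>) - real (N s \<omega>) = real (N (u - s) \<omega>)"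
      using ae by eventually_elim (use True in auto)
    then show ?thesis by (intro distr_cong_AE) auto
  next
    case False
    then have "s < u" using assms by simp
    have inc: "distr M (count_space UNIV) (\<lambda>\<omega>. N u \<omega> - N s \<omega>) =
        distr M (count_space UNIV) (\<lambda>\<omega>. N (u - s) \<omega> - N 0 \<omega>)"
      using N \<open>s < u\<close> assms(2) by (auto simp: poisson_process_def)
    have "distr M borel (\<lambda>\<omega>. real (N u \<omega>) - real (N s \<omega>)) =
        distr M borel (\<lambda>\<omega>. real (N u \<omega> - N s \<omega>))"
      using ae by (intro distr_cong_AE) (auto elim: eventually_mono)
    also have "\<dots> = distr (distr M (count_space UNIV) (\<lambda>\<omega>. N u \<omega> - N s \<omega>)) borel real"
      by (subst distr_distr) (auto simp: comp_def)
    also have "\<dots> = distr M borel (\<lambda>\<omega>. real (N (u - s) \<omega> - N 0 \<omega>))"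
      unfolding inc by (subst distr_distr) (auto simp: comp_def)
    also have "\<dots> = distr M borel (\<lambda>\<omega>. real (N (u - s) \<omega>))"
      using ae by (intro distr_cong_AE) (auto elim: eventually_mono)
    finally show ?thesis .
  qed
qed

section \<open>Random walks over blocks with deterministic boundaries\<close>

lemma mono_of_steps:
  fixes \<tau> :: "nat \<Rightarrow> 'a::order"
  assumes "\<And>i. i < n \<Longrightarrow> \<tau> i \<le> \<tau> (Suc i)" and "i \<le> j" and "j \<le> n"
  shows "\<tau> i \<le> \<tau> j"
  using assms(2,3)
proof (induction j rule: dec_induct)
  case (step m)
  then show ?case using assms(1)[of m] by (auto intro: order_trans)
qed simp

lemma disjoint_blocks:
  fixes a :: "nat \<Rightarrow> nat"
  assumes "\<And>i. i < n \<Longrightarrow> a i \<le> a (Suc i)"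
  shows "disjoint_family_on (\<lambda>i. {a i<..a (Suc i)}) {..<n}"
proof -
  have "{a i<..a (Suc i)} \<inter> {a j<..a (Suc j)} = {}" if "i < j" "j < n" for i j
    using mono_of_steps[of n a "Suc i" j] assms that by fastforce
  then show ?thesis
    unfolding disjoint_family_on_def
    by (metis Int_commute lessThan_iff linorder_neqE_nat)
qed

text \<open>The outer process of the first time change, at frozen times \<open>a l\<close>: disjoint
  blocks give independence, and stationarity holds because the law of a block sum depends only on
  the length of the block.\<close>

lemma (in prob_space) emeasure_increments_iid:
  fixes X :: "nat \<Rightarrow> 'a \<Rightarrow> real"
  assumes ind: "indep_vars (\<lambda>_. borel) X {1..}"
    and law: "\<And>i. 1 \<le> i \<Longrightarrow> distr M borel (X i) = \<mu>"
    and a: "\<And>l. l < n \<Longrightarrow> a l \<le> a (Suc l)" and B: "\<And>l. l < n \<Longrightarrow> B l \<in> sets borel"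
  shows "emeasure M {\<omega> \<in> space M. \<forall>l<n. (\<Sum>i\<in>{a l<..a (Suc l)}. X i \<omega>) \<in> B l} =
    (\<Prod>l<n. emeasure M {\<omega> \<in> space M. (\<Sum>i\<in>{0<..a (Suc l) - a l}. X i \<omega>) \<in> B l})"
proof -
  have rv: "X i \<in> borel_measurable M" if "1 \<le> i" for i
    using ind that by (auto simp: indep_vars_def)
  have sum_rv: "(\<lambda>\<omega>. \<Sum>i\<in>{b<..c}. X i \<omega>) \<in> borel_measurable M" for b c
    by (intro borel_measurable_sum rv) auto
  let ?V = "\<lambda>l \<omega>. \<Sum>i\<in>{a l<..a (Suc l)}. X i \<omega>"
  have blocks: "indep_vars (\<lambda>_. borel) ?V {..<n}"
    by (intro indep_vars_block_sums[OF ind] disjoint_blocks a) auto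
  have "prob {\<omega> \<in> space M. \<forall>l<n. ?V l \<omega> \<in> B l} = (\<Prod>l<n. prob {\<omega> \<in> space M. ?V l \<omega> \<in> B l})"
  \<comment> \<open>\<open>indep_varsD\<close> is about nonempty index sets, so the empty product is
    treated apart.\<close>
  proof (cases "n = 0")
    case True
    then show ?thesis by (simp add: prob_space)
  next
    case False
    have "{\<omega> \<in> space M. \<forall>l<n. ?V l \<omega> \<in> B l} = (\<Inter>l\<in>{..<n}. ?V l -` B l \<inter> space M)"
      using False by auto
    then show ?thesis
      using indep_varsD[OF blocks, of "{..<n}" B] False B
      by (simp add: vimage_def Int_def conj_commute lessThan_empty_iff)
  qed
  also have "prob {\<omega> \<in> space M. ?V l \<omega> \<in> B l} =
      prob {\<omega> \<in> space M. (\<Sum>i\<in>{0<..a (Suc l) - a l}. X i \<omega>) \<in> B l}" if "l < n" for l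
  proof -
    have "distr M borel (?V l) = distr M borel (\<lambda>\<omega>. \<Sum>i\<in>{0<..a (Suc l) - a l}. X i \<omega>)"
      using distr_sum_iid[OF ind law, of "a l" "a (Suc l) - a l"] a[OF that]
        distr_sum_iid[OF ind law, of 0 "a (Suc l) - a l"] by simp
    from arg_cong[OF this, of "\<lambda>D. measure D (B l)"] show ?thesis
      using B[OF that] sum_rv by (simp add: measure_distr vimage_def Int_def conj_commute)
  qed
  then have "(\<Prod>l<n. prob {\<omega> \<in> space M. ?V l \<omega> \<in> B l}) =
      (\<Prod>l<n. prob {\<omega> \<in> space M. (\<Sum>i\<in>{0<..a (Suc l) - a l}. X i \<omega>) \<in> B l})"
    by (intro prod.cong) auto
  finally show ?thesis
    by (simp add: emeasure_eq_measure prod_ennreal measure_nonneg)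
qed

lemma (in prob_space) indep_elements_sym:
  "indep_elements M A X B Y \<Longrightarrow> indep_elements M B Y A X"
  unfolding indep_elements_def indep_sets2_eq by (metis Int_commute mult.commute)

section \<open>Paths and increments of the process of order k\<close>

lemma (in prob_space) PPoK_measurable:
  assumes "PPoK M k lam Nk" and "0 \<le> t"
  shows "Nk t \<in> measurable M (count_space UNIV)"
proof -
  from assms(1) obtain N and X :: "nat \<Rightarrow> 'a \<Rightarrow> nat" where
    N: "poisson_process M (real k * lam) N"
    and X: "indep_vars (\<lambda>_. count_space UNIV) X {1..}"
    and Nk: "\<And>t \<omega>. 0 \<le> t \<Longrightarrow> \<omega> \<in> space M \<Longrightarrow> Nk t \<omega> = (\<Sum>i=1..N t \<omega>. X i \<omega>)"
    unfolding PPoK_def by blast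
  have [measurable]: "N t \<in> measurable M (count_space UNIV)"
    using N assms(2) by (auto simp: poisson_process_def)
  have "(\<lambda>\<omega>. \<Sum>i=1..m. X i \<omega>) \<in> measurable M (count_space UNIV)" for m
  proof (induction m)
    case (Suc m)
    note [measurable] = this
    have [measurable]: "X (Suc m) \<in> measurable M (count_space UNIV)"
      using X by (auto simp: indep_vars_def)
    have "(\<lambda>\<omega>. (\<Sum>i=1..m. X i \<omega>) + X (Suc m) \<omega>) \<in> measurable M (count_space UNIV)"
      by measurable
    then show ?case by simp
  qed simp
  then have "(\<lambda>\<omega>. \<Sum>i=1..N t \<omega>. X i \<omega>) \<in> measurable M (count_space UNIV)"
    by (rule measurable_compose_countable) measurable
  then show ?thesis
    using Nk[OF assms(2)] by (simp cong: measurable_cong)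
qed

text \<open>Pathwise, \<open>Nk\<close> is a nondecreasing function of the Poisson count. Since
  \<open>nat\<close> is discrete, right continuity means being constant immediately to the right,
  and this form passes through the random sum.\<close>

lemma (in prob_space) PPoK_paths:
  assumes "PPoK M k lam Nk"
  shows "AE \<omega> in M. Nk 0 \<omega> = 0 \<and> mono_on {0..} (\<lambda>t. Nk t \<omega>) \<and>
    (\<forall>t\<ge>0. \<forall>\<^sub>F u in at_right t. Nk u \<omega> = Nk t \<omega>)"
proof -
  from assms obtain N and X :: "nat \<Rightarrow> 'a \<Rightarrow> nat" where
    N: "poisson_process M (real k * lam) N"
    and Nk: "\<And>t \<omega>. 0 \<le> t \<Longrightarrow> \<omega> \<in> space M \<Longrightarrow> Nk t \<omega> = (\<Sum>i=1..N t \<omega>. X i \<omega>)"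
    unfolding PPoK_def by blast
  have "AE \<omega> in M. N 0 \<omega> = 0 \<and> mono_on {0..} (\<lambda>t. N t \<omega>) \<and>
        (\<forall>t\<ge>0. continuous (at_right t) (\<lambda>u. N u \<omega>))"
    using N by (simp add: poisson_process_def)
  then show ?thesis
  proof (rule AE_mp, intro AE_I2 impI conjI allI)
    fix \<omega> assume \<omega>: "\<omega> \<in> space M" and good: "N 0 \<omega> = 0 \<and> mono_on {0..} (\<lambda>t. N t \<omega>) \<and>
        (\<forall>t\<ge>0. continuous (at_right t) (\<lambda>u. N u \<omega>))"
    show "Nk 0 \<omega> = 0"
      using good Nk[of 0, OF _ \<omega>] by simp
    show "mono_on {0..} (\<lambda>t. Nk t \<omega>)"
    proof (rule mono_onI)
      fix r u :: real assume ru: "r \<in> {0..}" "u \<in> {0..}" "r \<le> u"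
      then have "N r \<omega> \<le> N u \<omega>" using good by (auto simp: mono_on_def)
      then show "Nk r \<omega> \<le> Nk u \<omega>"
        using ru \<omega> by (auto simp: Nk intro!: sum_mono2)
    qed
    fix t :: real assume "0 \<le> t"
    then have "((\<lambda>u. N u \<omega>) \<longlongrightarrow> N t \<omega>) (at_right t)"
      using good by (simp add: continuous_within)
    then have "\<forall>\<^sub>F u in at_right t. N u \<omega> \<in> {N t \<omega>}"
      by (rule topological_tendstoD) (simp_all add: Topological_Spaces.open_discrete)
    moreover have "\<forall>\<^sub>F u in at_right t. t < u"
      by (simp add: eventually_at_right_less)
    ultimately show "\<forall>\<^sub>F u in at_right t. Nk u \<omega> = Nk t \<omega>"
      by eventually_elim (use \<omega> \<open>0 \<le> t\<close> Nk in simp)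
  qed
qed

text \<open>The first time change. The fact \<open>marginal\<close> is the same Fubini computation
  at a single time; it turns the factors obtained by integrating over the Poisson path back into
  probabilities about \<open>Nk\<close>.\<close>

lemma (in prob_space) PPoK_increments:
  assumes "PPoK M k lam Nk" and s: "0 \<le> s 0" "\<And>l. l < n \<Longrightarrow> s l \<le> s (Suc l)"
  shows "emeasure M {\<omega> \<in> space M. \<forall>l<n. Nk (s (Suc l)) \<omega> = Nk (s l) \<omega> + j l} =
    (\<Prod>l<n. emeasure M {\<omega> \<in> space M. Nk (s (Suc l) - s l) \<omega> = j l})"
proof -
  note Nk_rv = PPoK_measurable[OF assms(1)]
  from assms(1) obtain N and X :: "nat \<Rightarrow> 'a \<Rightarrow> nat" where
    N: "poisson_process M (real k * lam) N"
    and X: "indep_vars (\<lambda>_. count_space UNIV) X {1..}"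
    and Xlaw: "\<And>i. 1 \<le> i \<Longrightarrow> distr M (count_space UNIV) (X i) = measure_pmf (pmf_of_set {1..k})"
    and NX: "indep_elements M (PiM {0..} (\<lambda>_. count_space UNIV)) (\<lambda>\<omega>. \<lambda>t\<in>{0..}. N t \<omega>)
          (PiM {1..} (\<lambda>_. count_space UNIV)) (\<lambda>\<omega>. \<lambda>i\<in>{1..}. X i \<omega>)"
    and Nk: "\<And>t \<omega>. 0 \<le> t \<Longrightarrow> \<omega> \<in> space M \<Longrightarrow> Nk t \<omega> = (\<Sum>i=1..N t \<omega>. X i \<omega>)"
    unfolding PPoK_def by blast
  let ?XS = "PiM {1..} (\<lambda>_. count_space UNIV) :: (nat \<Rightarrow> nat) measure"
  let ?NS = "PiM {0..} (\<lambda>_. count_space UNIV) :: (real \<Rightarrow> nat) measure"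
  let ?Xp = "\<lambda>\<omega>. \<lambda>i\<in>{1..}. X i \<omega>" and ?Np = "\<lambda>\<omega>. \<lambda>t\<in>{0..}. N t \<omega>"
  \<comment> \<open>Fubini freezes the second element, which here has to be the Poisson
    path.\<close>
  note XN = indep_elements_sym[OF NX]
  have N_rv: "N t \<in> measurable M (count_space UNIV)" if "0 \<le> t" for t
    using N that by (auto simp: poisson_process_def)
  have X_rv: "X i \<in> measurable M (count_space UNIV)" if "1 \<le> i" for i
    using X that by (auto simp: indep_vars_def)
  have N_ae: "AE \<omega> in M. mono_on {0..} (\<lambda>t. N t \<omega>)"
    using N by (auto simp: poisson_process_def)
  have s_nonneg: "0 \<le> s l" if "l \<le> n" for l
    using mono_of_steps[of n s 0 l] s that by force
  define \<mu> where "\<mu> = distr (measure_pmf (pmf_of_set {1..k})) borel real"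
  have XR: "indep_vars (\<lambda>_. borel) (\<lambda>i \<omega>. real (X i \<omega>)) {1..}"
    by (rule indep_vars_compose2[OF X]) simp
  have XRlaw: "distr M borel (\<lambda>\<omega>. real (X i \<omega>)) = \<mu>" if "1 \<le> i" for i
    unfolding \<mu>_def Xlaw[OF that, symmetric]
    by (subst distr_distr) (auto simp: comp_def X_rv[OF that])
  \<comment> \<open>Both ends of the block are random but take countably many values, so they are
    replaced by constants one after the other.\<close>
  have sum_meas: "(\<lambda>p. \<Sum>i\<in>{f p<..g p}. real (fst p i)) \<in> borel_measurable (?XS \<Otimes>\<^sub>M ?NS)"
    if fg: "f \<in> measurable (?XS \<Otimes>\<^sub>M ?NS) (count_space UNIV)"
      "g \<in> measurable (?XS \<Otimes>\<^sub>M ?NS) (count_space UNIV)" for f g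
  proof -
    have comp: "(\<lambda>p. real (fst p i)) \<in> borel_measurable (?XS \<Otimes>\<^sub>M ?NS)" if "1 \<le> i" for i
    proof -
      have "(\<lambda>p. fst p i) \<in> measurable (?XS \<Otimes>\<^sub>M ?NS) (count_space UNIV)"
        using that by (intro measurable_compose[OF measurable_fst measurable_component_singleton]) simp
      then show ?thesis by measurable
    qed
    have "(\<lambda>p. \<Sum>i\<in>{a<..b}. real (fst p i)) \<in> borel_measurable (?XS \<Otimes>\<^sub>M ?NS)" for a b
      by (intro borel_measurable_sum comp) auto
    then have "(\<lambda>p. \<Sum>i\<in>{a<..g p}. real (fst p i)) \<in> borel_measurable (?XS \<Otimes>\<^sub>M ?NS)" for a
      by (rule measurable_compose_countable) (rule fg)
    then show ?thesis
      by (rule measurable_compose_countable) (rule fg)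
  qed
  have eval: "(\<lambda>p. snd p t) \<in> measurable (?XS \<Otimes>\<^sub>M ?NS) (count_space UNIV)" if "0 \<le> t" for t
    using that by (intro measurable_compose[OF measurable_snd measurable_component_singleton]) simp
  \<comment> \<open>The probability that the walk is at \<open>i\<close> after \<open>a\<close>
    steps. The singleton of a real number is a Borel set, as \<open>emeasure_increments_iid\<close>
    expects.\<close>
  define r where "r i a = emeasure M {\<omega> \<in> space M. (\<Sum>i\<in>{0<..a}. real (X i \<omega>)) \<in> {real i}}" for i a
  have marginal: "emeasure M {\<omega> \<in> space M. Nk t \<omega> = i} = (\<integral>\<^sup>+\<omega>. r i (N t \<omega>) \<partial>M)" if t: "0 \<le> t" for t i
  proof -
    let ?E = "{p \<in> space (?XS \<Otimes>\<^sub>M ?NS). (\<Sum>i\<in>{0<..snd p t}. real (fst p i)) \<in> {real i}}"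
    have E: "?E \<in> sets (?XS \<Otimes>\<^sub>M ?NS)"
      by (intro sets_Collect_vimage[OF sum_meas] measurable_const eval t) auto
    have sp: "(?Xp \<omega>', ?Np \<omega>) \<in> ?E \<longleftrightarrow> (\<Sum>i\<in>{0<..N t \<omega>}. real (X i \<omega>')) \<in> {real i}" for \<omega> \<omega>'
      using t by (auto simp: space_pair_measure space_PiM)
    have "Nk t \<omega> = i \<longleftrightarrow> (\<Sum>i\<in>{0<..N t \<omega>}. real (X i \<omega>)) \<in> {real i}" if "\<omega> \<in> space M" for \<omega>
    proof -
      have "{0<..N t \<omega>} = {1..N t \<omega>}" by auto
      then show ?thesis using Nk[OF t that] by (simp flip: of_nat_sum)
    qed
    then have "{\<omega> \<in> space M. Nk t \<omega> = i} = {\<omega> \<in> space M. (?Xp \<omega>, ?Np \<omega>) \<in> ?E}"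
      unfolding sp by auto
    then have "emeasure M {\<omega> \<in> space M. Nk t \<omega> = i} = emeasure M {\<omega> \<in> space M. (?Xp \<omega>, ?Np \<omega>) \<in> ?E}"
      by simp
    also have "\<dots> = (\<integral>\<^sup>+\<omega>. emeasure M {\<omega>' \<in> space M. (?Xp \<omega>', ?Np \<omega>) \<in> ?E} \<partial>M)"
      by (rule indep_elements_emeasure[OF XN E])
    finally show ?thesis
      unfolding sp r_def .
  qed
  let ?E = "{p \<in> space (?XS \<Otimes>\<^sub>M ?NS).
    \<forall>l\<in>{..<n}. (\<Sum>i\<in>{snd p (s l)<..snd p (s (Suc l))}. real (fst p i)) \<in> {real (j l)}}"
  have E: "?E \<in> sets (?XS \<Otimes>\<^sub>M ?NS)"
  proof (rule sets.sets_Collect_finite_All)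
    fix l assume "l \<in> {..<n}"
    then show "{p \<in> space (?XS \<Otimes>\<^sub>M ?NS).
        (\<Sum>i\<in>{snd p (s l)<..snd p (s (Suc l))}. real (fst p i)) \<in> {real (j l)}} \<in> sets (?XS \<Otimes>\<^sub>M ?NS)"
      using s_nonneg by (intro sets_Collect_vimage[OF sum_meas] eval) auto
  qed simp
  have sp: "(?Xp \<omega>', ?Np \<omega>) \<in> ?E \<longleftrightarrow>
      (\<forall>l<n. (\<Sum>i\<in>{N (s l) \<omega><..N (s (Suc l)) \<omega>}. real (X i \<omega>')) \<in> {real (j l)})" for \<omega> \<omega>'
    using s_nonneg by (auto simp: space_pair_measure space_PiM)
  have "emeasure M {\<omega> \<in> space M. \<forall>l<n. Nk (s (Suc l)) \<omega> = Nk (s l) \<omega> + j l} =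
      emeasure M {\<omega> \<in> space M. (?Xp \<omega>, ?Np \<omega>) \<in> ?E}"
  proof (rule emeasure_Collect_cong_AE)
    show "AE \<omega> in M. (\<forall>l<n. Nk (s (Suc l)) \<omega> = Nk (s l) \<omega> + j l) \<longleftrightarrow> (?Xp \<omega>, ?Np \<omega>) \<in> ?E"
      using N_ae
    proof (rule AE_mp, intro AE_I2 impI)
      fix \<omega> assume \<omega>: "\<omega> \<in> space M" and mono: "mono_on {0..} (\<lambda>t. N t \<omega>)"
      have "Nk (s (Suc l)) \<omega> = Nk (s l) \<omega> + j l \<longleftrightarrow>
          (\<Sum>i\<in>{N (s l) \<omega><..N (s (Suc l)) \<omega>}. real (X i \<omega>)) \<in> {real (j l)}" if "l < n" for l
      proof -
        have "N (s l) \<omega> \<le> N (s (Suc l)) \<omega>"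
          using mono s(2)[OF that] s_nonneg[of l] s_nonneg[of "Suc l"] that by (auto simp: mono_on_def)
        then have "{1..N (s (Suc l)) \<omega>} = {1..N (s l) \<omega>} \<union> {N (s l) \<omega><..N (s (Suc l)) \<omega>}"
          by auto
        then have "(\<Sum>i=1..N (s (Suc l)) \<omega>. X i \<omega>) =
            (\<Sum>i=1..N (s l) \<omega>. X i \<omega>) + (\<Sum>i\<in>{N (s l) \<omega><..N (s (Suc l)) \<omega>}. X i \<omega>)"
          by (simp only:) (intro sum.union_disjoint, auto)
        then have "Nk (s (Suc l)) \<omega> = Nk (s l) \<omega> + (\<Sum>i\<in>{N (s l) \<omega><..N (s (Suc l)) \<omega>}. X i \<omega>)"
          using s_nonneg[of l] s_nonneg[of "Suc l"] that \<omega> by (simp add: Nk)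
        then show ?thesis by (simp flip: of_nat_sum)
      qed
      then show "(\<forall>l<n. Nk (s (Suc l)) \<omega> = Nk (s l) \<omega> + j l) \<longleftrightarrow> (?Xp \<omega>, ?Np \<omega>) \<in> ?E"
        unfolding sp by auto
    qed
    have "{\<omega> \<in> space M. \<forall>l\<in>{..<n}. Nk (s (Suc l)) \<omega> = Nk (s l) \<omega> + j l} \<in> sets M"
    proof (rule sets.sets_Collect_finite_All)
      fix l assume "l \<in> {..<n}"
      then show "{\<omega> \<in> space M. Nk (s (Suc l)) \<omega> = Nk (s l) \<omega> + j l} \<in> sets M"
        using s_nonneg by (intro sets_Collect_eq_add Nk_rv) auto
    qed simp
    then show "{\<omega> \<in> space M. \<forall>l<n. Nk (s (Suc l)) \<omega> = Nk (s l) \<omega> + j l} \<in> sets M"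
      by (simp only: Ball_def lessThan_iff)
    have "?Xp \<in> measurable M ?XS" "?Np \<in> measurable M ?NS"
      using NX by (auto simp: indep_elements_def)
    then show "{\<omega> \<in> space M. (?Xp \<omega>, ?Np \<omega>) \<in> ?E} \<in> sets M"
      by (intro sets_Collect_vimage[OF measurable_Pair E])
  qed
  also have "\<dots> = (\<integral>\<^sup>+\<omega>. emeasure M {\<omega>' \<in> space M. (?Xp \<omega>', ?Np \<omega>) \<in> ?E} \<partial>M)"
    by (rule indep_elements_emeasure[OF XN E])
  \<comment> \<open>Rounding extends \<open>r (j l)\<close> from counts to a Borel function of a
    real argument, so that it can play the role of \<open>g\<close> for a real-valued process. On
    nonnegative differences of counts it changes nothing.\<close>
  also have "\<dots> = (\<integral>\<^sup>+\<omega>. (\<Prod>l<n. r (j l) (nat \<lfloor>real (N (s (Suc l)) \<omega>) - real (N (s l) \<omega>)\<rfloor>)) \<partial>M)"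
  proof (rule nn_integral_cong_AE, use N_ae in eventually_elim)
    fix \<omega> assume mono: "mono_on {0..} (\<lambda>t. N t \<omega>)"
    have le: "N (s l) \<omega> \<le> N (s (Suc l)) \<omega>" if "l < n" for l
      using mono s(2)[OF that] s_nonneg[of l] s_nonneg[of "Suc l"] that by (auto simp: mono_on_def)
    then have nat: "nat \<lfloor>real (N (s (Suc l)) \<omega>) - real (N (s l) \<omega>)\<rfloor> = N (s (Suc l)) \<omega> - N (s l) \<omega>"
      if "l < n" for l
      using le[OF that] by (simp flip: of_nat_diff)
    have "emeasure M {\<omega>' \<in> space M. (?Xp \<omega>', ?Np \<omega>) \<in> ?E} =
        (\<Prod>l<n. r (j l) (N (s (Suc l)) \<omega> - N (s l) \<omega>))"
      unfolding sp r_def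
      by (rule emeasure_increments_iid[where a = "\<lambda>l. N (s l) \<omega>" and \<mu> = \<mu>
        and B = "\<lambda>l. {real (j l)}", OF XR]) (simp_all add: XRlaw le)
    also have "\<dots> = (\<Prod>l<n. r (j l) (nat \<lfloor>real (N (s (Suc l)) \<omega>) - real (N (s l) \<omega>)\<rfloor>))"
      by (rule prod.cong) (simp_all only: nat lessThan_iff)
    finally show "emeasure M {\<omega>' \<in> space M. (?Xp \<omega>', ?Np \<omega>) \<in> ?E} =
        (\<Prod>l<n. r (j l) (nat \<lfloor>real (N (s (Suc l)) \<omega>) - real (N (s l) \<omega>)\<rfloor>))" .
  qed
  also have "\<dots> = (\<Prod>l<n. \<integral>\<^sup>+\<omega>. r (j l) (nat \<lfloor>real (N (s (Suc l) - s l) \<omega>)\<rfloor>) \<partial>M)"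
  proof (rule nn_integral_prod_increments[where T = "\<lambda>t \<omega>. real (N t \<omega>)" and \<tau> = s
      and g = "\<lambda>l x. r (j l) (nat \<lfloor>x\<rfloor>)"])
    show "independent_increments M (\<lambda>t \<omega>. real (N t \<omega>))"
      using N by (simp add: poisson_process_def)
    show "(\<lambda>\<omega>. real (N u \<omega>)) \<in> borel_measurable M" if "0 \<le> u" for u
      using N_rv[OF that] by measurable
    show "distr M borel (\<lambda>\<omega>. real (N u \<omega>) - real (N t \<omega>)) = distr M borel (\<lambda>\<omega>. real (N (u - t) \<omega>))"
      if "0 \<le> t" "t \<le> u" for t u
      using that by (rule poisson_process_increments[OF N])
    show "(\<lambda>x::real. r (j l) (nat \<lfloor>x\<rfloor>)) \<in> borel_measurable borel" for l
    proof (rule measurable_compose[where f = "\<lambda>x::real. nat \<lfloor>x\<rfloor>" and N = "count_space UNIV"])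
      show "(\<lambda>x::real. nat \<lfloor>x\<rfloor>) \<in> measurable borel (count_space UNIV)"
        by measurable
    qed simp
    show "0 \<le> s 0" by (rule s)
    show "s i \<le> s (Suc i)" if "i < n" for i using that by (rule s)
  qed
  also have "\<dots> = (\<Prod>l<n. emeasure M {\<omega> \<in> space M. Nk (s (Suc l) - s l) \<omega> = j l})"
    using s by (intro prod.cong) (simp_all add: marginal)
  finally show ?thesis .
qed

section \<open>Evaluation at an independent random time\<close>

text \<open>The least multiple of \<open>1 / (m + 1)\<close> strictly above \<open>u\<close>, for \<open>u \<ge> 0\<close>.\<close>

definition grid :: "nat \<Rightarrow> real \<Rightarrow> real" where
  "grid m u = real (nat \<lfloor>real (Suc m) * u\<rfloor> + 1) / real (Suc m)"

lemma grid_nonneg: "0 \<le> grid m u"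
  by (simp add: grid_def)

text \<open>Grid points lie strictly to the right of \<open>u\<close> because
  \<open>at_right\<close> excludes \<open>u\<close> itself, and that is the side on which the paths
  of \<open>Nk\<close> are known to be locally constant.\<close>

lemma filterlim_grid:
  assumes "0 \<le> u"
  shows "filterlim (\<lambda>m. grid m u) (at_right u) sequentially"
proof -
  have bnd: "u < grid m u \<and> grid m u \<le> u + 1 / real (Suc m)" for m
  proof -
    define x where "x = real (Suc m) * u"
    have "0 \<le> x" using assms by (simp add: x_def)
    then have "real (nat \<lfloor>x\<rfloor>) = of_int \<lfloor>x\<rfloor>" by simp
    moreover have "real_of_int \<lfloor>x\<rfloor> \<le> x" "x < real_of_int \<lfloor>x\<rfloor> + 1" by linarith+
    ultimately have "x < real (nat \<lfloor>x\<rfloor>) + 1" "real (nat \<lfloor>x\<rfloor>) + 1 \<le> x + 1"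
      by linarith+
    then have "x / real (Suc m) < grid m u" "grid m u \<le> (x + 1) / real (Suc m)"
      unfolding grid_def x_def[symmetric] of_nat_add of_nat_1
      by (simp_all add: divide_strict_right_mono divide_right_mono)
    moreover have "x / real (Suc m) = u" by (simp add: x_def)
    ultimately show ?thesis by (simp add: add_divide_distrib)
  qed
  have upper: "(\<lambda>m. u + 1 / real (Suc m)) \<longlonglongrightarrow> u"
    using tendsto_add[OF tendsto_const[of u] LIMSEQ_Suc[OF lim_1_over_n]] by simp
  have "(\<lambda>m. grid m u) \<longlonglongrightarrow> u"
  proof (rule tendsto_sandwich[OF _ _ tendsto_const upper])
    show "\<forall>\<^sub>F m in sequentially. u \<le> grid m u"
      using bnd by (intro always_eventually allI less_imp_le) blast
    show "\<forall>\<^sub>F m in sequentially. grid m u \<le> u + 1 / real (Suc m)"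
      using bnd by (intro always_eventually allI) blast
  qed
  moreover have "\<forall>\<^sub>F m in sequentially. grid m u \<in> {u<..} \<and> grid m u \<noteq> u"
  proof (intro always_eventually allI)
    fix m
    have "u < grid m u" using bnd by blast
    then show "grid m u \<in> {u<..} \<and> grid m u \<noteq> u" by simp
  qed
  ultimately show ?thesis
    unfolding filterlim_at by blast
qed

lemma eventually_grid:
  fixes f :: "real \<Rightarrow> nat"
  assumes "\<forall>t\<ge>0. \<forall>\<^sub>F u in at_right t. f u = f t" and "0 \<le> u"
  shows "\<forall>\<^sub>F m in sequentially. f (grid m u) = f u"
  using filterlim_grid[OF assms(2)] assms unfolding filterlim_iff by blast

lemma eventually_grid_iff:
  fixes f :: "real \<Rightarrow> nat"
  assumes f: "\<forall>t\<ge>0. \<forall>\<^sub>F u in at_right t. f u = f t" and "0 \<le> u" "0 \<le> v"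
  shows "(\<forall>\<^sub>F m in sequentially. f (grid m u) = f (grid m v) + i) \<longleftrightarrow> f u = f v + i"
proof -
  have "\<forall>\<^sub>F m in sequentially. f (grid m u) = f u \<and> f (grid m v) = f v"
    using assms by (intro eventually_conj eventually_grid)
  then have "(\<forall>\<^sub>F m in sequentially. f (grid m u) = f (grid m v) + i) \<longleftrightarrow>
      (\<forall>\<^sub>F m::nat in sequentially. f u = f v + i)"
    by (rule eventually_cong) auto
  then show ?thesis by simp
qed

text \<open>For fixed \<open>m\<close> the time takes only the countably many values (i + 1) / (m +
  1), and evaluation at each of them is a coordinate projection.\<close>

lemma measurable_path_at_grid:
  assumes f: "f \<in> measurable L (PiM {0..} (\<lambda>_. count_space UNIV))"
    and g: "g \<in> borel_measurable L"
  shows "(\<lambda>p. (f p :: real \<Rightarrow> nat) (grid m (g p))) \<in> measurable L (count_space UNIV)"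
proof -
  have "(\<lambda>p. f p (real (i + 1) / real (Suc m))) \<in> measurable L (count_space UNIV)" for i
    by (intro measurable_compose[OF f measurable_component_singleton]) auto
  moreover have "(\<lambda>p. nat \<lfloor>real (Suc m) * g p\<rfloor>) \<in> measurable L (count_space UNIV)"
    using g by measurable
  ultimately show ?thesis
    unfolding grid_def by (rule measurable_compose_countable)
qed

lemma levy_subordinator_AE:
  assumes "levy_subordinator M S"
  shows "AE \<omega> in M. S 0 \<omega> = 0 \<and> mono_on {0..} (\<lambda>t. S t \<omega>)"
  using assms unfolding levy_subordinator_def levy_process_def by auto

text \<open>
  \<open>Nk (S t)\<close> is not a measurable function of the pair of paths, since evaluating a path in an
  uncountable product space at a random time is not measurable.  Almost surely it agrees with the
  eventual value of \<open>Nk\<close> along the grid points \<open>grid m (S t)\<close>, which is measurable, so Fubini applies.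
\<close>

locale random_time_change = prob_space M for M :: "'a measure" +
  fixes k :: nat and lam :: real and Nk :: "real \<Rightarrow> 'a \<Rightarrow> nat"
    and Y :: "nat \<Rightarrow> 'a \<Rightarrow> real" and S :: "real \<Rightarrow> 'a \<Rightarrow> real"
  assumes Nk: "PPoK M k lam Nk"
    and indep_NkY: "indep_elements M
       (PiM {0..} (\<lambda>_. count_space UNIV)) (\<lambda>\<omega>. \<lambda>t\<in>{0..}. Nk t \<omega>)
       (PiM {1..} (\<lambda>_. borel)) (\<lambda>\<omega>. \<lambda>i\<in>{1..}. Y i \<omega>)"
    and S: "levy_subordinator M S"
    and indep_S: "indep_elements M
       (PiM {0..} (\<lambda>_. count_space UNIV) \<Otimes>\<^sub>M PiM {1..} (\<lambda>_. borel))
       (\<lambda>\<omega>. (\<lambda>t\<in>{0..}. Nk t \<omega>, \<lambda>i\<in>{1..}. Y i \<omega>))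
       (PiM {0..} (\<lambda>_. borel)) (\<lambda>\<omega>. \<lambda>t\<in>{0..}. S t \<omega>)"
    and NkS_measurable: "0 \<le> t \<Longrightarrow> (\<lambda>\<omega>. Nk (S t \<omega>) \<omega>) \<in> measurable M (count_space UNIV)"
begin

abbreviation "Nspace \<equiv> (PiM {0..} (\<lambda>_. count_space UNIV) :: (real \<Rightarrow> nat) measure)"
abbreviation "Yspace \<equiv> (PiM {1..} (\<lambda>_. borel) :: (nat \<Rightarrow> real) measure)"
abbreviation "Sspace \<equiv> (PiM {0..} (\<lambda>_. borel) :: (real \<Rightarrow> real) measure)"
abbreviation "Npath \<equiv> (\<lambda>\<omega>. \<lambda>t\<in>{0..}. Nk t \<omega>)"
abbreviation "Ypath \<equiv> (\<lambda>\<omega>. \<lambda>i\<in>{1..}. Y i \<omega>)"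
abbreviation "Spath \<equiv> (\<lambda>\<omega>. \<lambda>t\<in>{0..}. S t \<omega>)"

lemma Npath_measurable: "Npath \<in> measurable M Nspace"
  and Ypath_measurable: "Ypath \<in> measurable M Yspace"
  and Spath_measurable: "Spath \<in> measurable M Sspace"
  using indep_NkY indep_S by (auto simp: indep_elements_def)

lemma Nk_right_continuous: "AE \<omega> in M. \<forall>t\<ge>0. \<forall>\<^sub>F u in at_right t. Nk u \<omega> = Nk t \<omega>"
  using PPoK_paths[OF Nk] by (auto elim: eventually_mono)

text \<open>Defined through the grid values in order to be Borel measurable in \<open>u\<close> without
  knowing that the one-dimensional laws of \<open>Nk\<close> depend continuously on time.\<close>

definition Nk_prob :: "nat \<Rightarrow> real \<Rightarrow> ennreal" where
  "Nk_prob i u = emeasure M {\<omega> \<in> space M. \<forall>\<^sub>F m in sequentially. Nk (grid m u) \<omega> = i}"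

lemma Ypath_sets: "B \<in> sets Yspace \<Longrightarrow> {\<omega> \<in> space M. Ypath \<omega> \<in> B} \<in> sets M"
  by (rule sets_Collect_vimage[OF Ypath_measurable])

lemma Nk_prob_measurable [measurable]: "Nk_prob i \<in> borel_measurable borel"
proof -
  let ?E = "{p \<in> space (Nspace \<Otimes>\<^sub>M borel). \<forall>\<^sub>F m in sequentially. fst p (grid m (snd p)) = i}"
  \<comment> \<open>Written \<open>0 + i\<close> to fit the eventual equation of two sequences, the
    second one being constantly 0.\<close>
  have "{p \<in> space (Nspace \<Otimes>\<^sub>M borel). \<forall>\<^sub>F m in sequentially. fst p (grid m (snd p)) = 0 + i} \<in>
      sets (Nspace \<Otimes>\<^sub>M borel)"
    by (intro sets_Collect_eventually_eq_add measurable_path_at_grid measurable_fst measurable_snd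
      measurable_const) simp
  then have "?E \<in> sets (Nspace \<Otimes>\<^sub>M borel)" by simp
  from measurable_emeasure_section[OF Npath_measurable this]
  show ?thesis
    by (simp add: Nk_prob_def[abs_def] space_pair_measure space_PiM grid_nonneg)
qed

lemma Nk_prob_eq: "0 \<le> u \<Longrightarrow> Nk_prob i u = emeasure M {\<omega> \<in> space M. Nk u \<omega> = i}"
  unfolding Nk_prob_def
proof (rule emeasure_Collect_cong_AE)
  assume u: "0 \<le> u"
  have [measurable]: "Nk (grid m u) \<in> measurable M (count_space UNIV)" for m
    by (rule PPoK_measurable[OF Nk grid_nonneg])
  show "{\<omega> \<in> space M. \<forall>\<^sub>F m in sequentially. Nk (grid m u) \<omega> = i} \<in> sets M"
    unfolding eventually_sequentially by measurable
  have [measurable]: "Nk u \<in> measurable M (count_space UNIV)"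
    by (rule PPoK_measurable[OF Nk u])
  show "{\<omega> \<in> space M. Nk u \<omega> = i} \<in> sets M"
    by measurable
  show "AE \<omega> in M. (\<forall>\<^sub>F m in sequentially. Nk (grid m u) \<omega> = i) \<longleftrightarrow> Nk u \<omega> = i"
    using Nk_right_continuous
  proof eventually_elim
    fix \<omega> assume rc: "\<forall>t\<ge>0. \<forall>\<^sub>F u in at_right t. Nk u \<omega> = Nk t \<omega>"
    note ev = eventually_grid[OF rc u]
    have "(\<forall>\<^sub>F m in sequentially. Nk (grid m u) \<omega> = i) \<longleftrightarrow> (\<forall>\<^sub>F m::nat in sequentially. Nk u \<omega> = i)"
      by (rule eventually_cong[OF ev]) simp
    then show "(\<forall>\<^sub>F m in sequentially. Nk (grid m u) \<omega> = i) \<longleftrightarrow> Nk u \<omega> = i"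
      by simp
  qed
qed

lemma sets_increments:
  assumes "0 \<le> s 0" "\<And>l. l < n \<Longrightarrow> s l \<le> s (Suc l)"
  shows "{\<omega> \<in> space M. \<forall>l<n. Nk (s (Suc l)) \<omega> = Nk (s l) \<omega> + j l} \<in> sets M"
proof -
  have Nks: "Nk (s l) \<in> measurable M (count_space UNIV)" if "l \<le> n" for l
  proof (rule PPoK_measurable[OF Nk])
    show "0 \<le> s l"
      using mono_of_steps[of n s 0 l, OF assms(2)] assms(1) that by simp
  qed
  have "{\<omega> \<in> space M. \<forall>l\<in>{..<n}. Nk (s (Suc l)) \<omega> = Nk (s l) \<omega> + j l} \<in> sets M"
  proof (rule sets.sets_Collect_finite_All)
    fix l assume "l \<in> {..<n}"
    then have "Suc l \<le> n" "l \<le> n" by auto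
    then show "{\<omega> \<in> space M. Nk (s (Suc l)) \<omega> = Nk (s l) \<omega> + j l} \<in> sets M"
      by (rule sets_Collect_eq_add[OF Nks Nks])
  qed (rule finite_lessThan)
  then show ?thesis unfolding Ball_def lessThan_iff .
qed

lemma emeasure_increments_Y:
  assumes s: "0 \<le> s 0" "\<And>l. l < n \<Longrightarrow> s l \<le> s (Suc l)" and B: "B \<in> sets Yspace"
  shows "emeasure M {\<omega> \<in> space M. (\<forall>l<n. Nk (s (Suc l)) \<omega> = Nk (s l) \<omega> + j l) \<and> Ypath \<omega> \<in> B} =
    (\<Prod>l<n. Nk_prob (j l) (s (Suc l) - s l)) * emeasure M {\<omega> \<in> space M. Ypath \<omega> \<in> B}"
proof -
  let ?A = "{\<omega> \<in> space M. \<forall>l<n. Nk (s (Suc l)) \<omega> = Nk (s l) \<omega> + j l}"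
  let ?A' = "{w \<in> space Nspace. \<forall>l\<in>{..<n}. w (s (Suc l)) = w (s l) + j l}"
  have s_nonneg: "0 \<le> s l" if "l \<le> n" for l
    using mono_of_steps[of n s 0 l] s that by force
  have "?A' \<in> sets Nspace"
  proof (rule sets.sets_Collect_finite_All)
    fix l assume "l \<in> {..<n}"
    then show "{w \<in> space Nspace. w (s (Suc l)) = w (s l) + j l} \<in> sets Nspace"
      using s_nonneg by (intro sets_Collect_eq_add measurable_component_singleton) auto
  qed simp
  then have "Npath -` ?A' \<inter> space M \<in> sets (vimage_algebra (space M) Npath Nspace)"
    by (rule in_vimage_algebra)
  moreover have "Npath \<omega> \<in> ?A' \<longleftrightarrow> (\<forall>l<n. Nk (s (Suc l)) \<omega> = Nk (s l) \<omega> + j l)" for \<omega>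
    using s_nonneg by (auto simp: space_PiM)
  then have "Npath -` ?A' \<inter> space M = ?A"
    by blast
  ultimately have A: "?A \<in> sets (vimage_algebra (space M) Npath Nspace)"
    by (simp only:)
  have "indep_set (sets (vimage_algebra (space M) Npath Nspace)) (sets (vimage_algebra (space M) Ypath Yspace))"
    using indep_NkY unfolding indep_elements_def by blast
  then have "prob (?A \<inter> (Ypath -` B \<inter> space M)) = prob ?A * prob (Ypath -` B \<inter> space M)"
    using A in_vimage_algebra[OF B] by (rule indep_setD)
  moreover have "Ypath -` B \<inter> space M = {\<omega> \<in> space M. Ypath \<omega> \<in> B}" by auto
  moreover have "?A \<inter> {\<omega> \<in> space M. Ypath \<omega> \<in> B} =
      {\<omega> \<in> space M. (\<forall>l<n. Nk (s (Suc l)) \<omega> = Nk (s l) \<omega> + j l) \<and> Ypath \<omega> \<in> B}" by auto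
  ultimately have "emeasure M {\<omega> \<in> space M. (\<forall>l<n. Nk (s (Suc l)) \<omega> = Nk (s l) \<omega> + j l) \<and> Ypath \<omega> \<in> B} =
      emeasure M ?A * emeasure M {\<omega> \<in> space M. Ypath \<omega> \<in> B}"
    by (simp add: emeasure_eq_measure ennreal_mult)
  also have "emeasure M ?A = (\<Prod>l<n. emeasure M {\<omega> \<in> space M. Nk (s (Suc l) - s l) \<omega> = j l})"
    by (rule PPoK_increments[OF Nk s(1) s(2)])
  also have "\<dots> = (\<Prod>l<n. Nk_prob (j l) (s (Suc l) - s l))"
    by (intro prod.cong) (simp_all add: Nk_prob_eq s)
  finally show ?thesis .
qed

text \<open>Fubini is applied to the event \<open>?E\<close> read off along the grid, and both sides
  are then compared with the intended event. Before Fubini that event is measurable by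
  \<open>NkS_measurable\<close>; afterwards, with the times frozen, because finitely many
  deterministic times are involved.\<close>

lemma emeasure_subordinated_mixture:
  assumes \<tau>: "0 \<le> \<tau> 0" "\<And>l. l < n \<Longrightarrow> \<tau> l \<le> \<tau> (Suc l)" and B: "B \<in> sets Yspace"
  shows "emeasure M {\<omega> \<in> space M.
      (\<forall>l<n. Nk (S (\<tau> (Suc l)) \<omega>) \<omega> = Nk (S (\<tau> l) \<omega>) \<omega> + j l) \<and> Ypath \<omega> \<in> B} =
    (\<integral>\<^sup>+\<omega>. (\<Prod>l<n. Nk_prob (j l) (S (\<tau> (Suc l)) \<omega> - S (\<tau> l) \<omega>)) \<partial>M) *
      emeasure M {\<omega> \<in> space M. Ypath \<omega> \<in> B}"
proof -
  have \<tau>_nonneg: "0 \<le> \<tau> l" if "l \<le> n" for l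
    using mono_of_steps[of n \<tau> 0 l] \<tau> that by force
  let ?P = "(Nspace \<Otimes>\<^sub>M Yspace) \<Otimes>\<^sub>M Sspace"
  let ?E = "{p \<in> space ?P. (\<forall>l\<in>{..<n}. \<forall>\<^sub>F m in sequentially.
      fst (fst p) (grid m (snd p (\<tau> (Suc l)))) = fst (fst p) (grid m (snd p (\<tau> l))) + j l) \<and>
      snd (fst p) \<in> B}"
  let ?A = "{\<omega> \<in> space M.
      (\<forall>l<n. Nk (S (\<tau> (Suc l)) \<omega>) \<omega> = Nk (S (\<tau> l) \<omega>) \<omega> + j l) \<and> Ypath \<omega> \<in> B}"
  have path_meas: "(\<lambda>p. fst (fst p) (grid m (snd p t))) \<in> measurable ?P (count_space UNIV)"
    if "0 \<le> t" for t m
    using that by (intro measurable_path_at_grid measurable_compose[OF measurable_fst measurable_fst]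
      measurable_compose[OF measurable_snd measurable_component_singleton]) simp
  have E: "?E \<in> sets ?P"
  proof (intro sets.sets_Collect_conj sets.sets_Collect_finite_All)
    fix l assume "l \<in> {..<n}"
    then show "{p \<in> space ?P. \<forall>\<^sub>F m in sequentially.
      fst (fst p) (grid m (snd p (\<tau> (Suc l)))) = fst (fst p) (grid m (snd p (\<tau> l))) + j l} \<in> sets ?P"
      using \<tau>_nonneg by (intro sets_Collect_eventually_eq_add path_meas) auto
  next
    show "{p \<in> space ?P. snd (fst p) \<in> B} \<in> sets ?P"
      by (rule sets_Collect_vimage[OF measurable_compose[OF measurable_fst measurable_snd] B])
  qed simp
  have sp: "((Npath \<omega>', Ypath \<omega>'), Spath \<omega>) \<in> ?E \<longleftrightarrow>
      (\<forall>l<n. \<forall>\<^sub>F m in sequentially.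
        Nk (grid m (S (\<tau> (Suc l)) \<omega>)) \<omega>' = Nk (grid m (S (\<tau> l) \<omega>)) \<omega>' + j l) \<and> Ypath \<omega>' \<in> B"
    for \<omega> \<omega>'
    using \<tau>_nonneg by (auto simp: space_pair_measure space_PiM grid_nonneg)
  have S_nonneg: "0 \<le> S (\<tau> l) \<omega>" if "S 0 \<omega> = 0 \<and> mono_on {0..} (\<lambda>t. S t \<omega>)" "l \<le> n" for l \<omega>
    using that \<tau>_nonneg[OF that(2)] mono_onD[of "{0..}" "\<lambda>t. S t \<omega>" 0 "\<tau> l"] by simp
  \<comment> \<open>The point \<omega> supplies the times and \<omega>' the path of
    \<open>Nk\<close>. This is used once on the diagonal and once with \<omega> frozen under the
    integral.\<close>
  have E_iff: "((Npath \<omega>', Ypath \<omega>'), Spath \<omega>) \<in> ?E \<longleftrightarrow>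
      (\<forall>l<n. Nk (S (\<tau> (Suc l)) \<omega>) \<omega>' = Nk (S (\<tau> l) \<omega>) \<omega>' + j l) \<and> Ypath \<omega>' \<in> B"
    if "S 0 \<omega> = 0 \<and> mono_on {0..} (\<lambda>t. S t \<omega>)"
      "\<forall>t\<ge>0. \<forall>\<^sub>F u in at_right t. Nk u \<omega>' = Nk t \<omega>'" for \<omega> \<omega>'
  proof -
    have "(\<forall>\<^sub>F m in sequentially.
        Nk (grid m (S (\<tau> (Suc l)) \<omega>)) \<omega>' = Nk (grid m (S (\<tau> l) \<omega>)) \<omega>' + j l) \<longleftrightarrow>
        Nk (S (\<tau> (Suc l)) \<omega>) \<omega>' = Nk (S (\<tau> l) \<omega>) \<omega>' + j l" if "l < n" for l
      using that by (intro eventually_grid_iff[of "\<lambda>u. Nk u \<omega>'"] S_nonneg \<open>\<forall>t\<ge>0. _ t\<close> \<open>S 0 \<omega> = 0 \<and> _\<close>) auto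
    then show ?thesis unfolding sp by auto
  qed
  have path: "(\<lambda>\<omega>. (Npath \<omega>, Ypath \<omega>)) \<in> measurable M (Nspace \<Otimes>\<^sub>M Yspace)"
    using Npath_measurable Ypath_measurable by (rule measurable_Pair)
  have "emeasure M ?A = emeasure M {\<omega> \<in> space M. ((Npath \<omega>, Ypath \<omega>), Spath \<omega>) \<in> ?E}"
  proof (rule emeasure_Collect_cong_AE)
    show "AE \<omega> in M. ((\<forall>l<n. Nk (S (\<tau> (Suc l)) \<omega>) \<omega> = Nk (S (\<tau> l) \<omega>) \<omega> + j l) \<and> Ypath \<omega> \<in> B) \<longleftrightarrow>
        ((Npath \<omega>, Ypath \<omega>), Spath \<omega>) \<in> ?E"
      using levy_subordinator_AE[OF S] Nk_right_continuous
    proof eventually_elim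
      case (elim \<omega>)
      show ?case unfolding E_iff[OF elim] ..
    qed
    have "?A = {\<omega> \<in> space M. (\<forall>l\<in>{..<n}. Nk (S (\<tau> (Suc l)) \<omega>) \<omega> = Nk (S (\<tau> l) \<omega>) \<omega> + j l) \<and> Ypath \<omega> \<in> B}"
      by auto
    also have "\<dots> \<in> sets M"
    proof (intro sets.sets_Collect_conj sets.sets_Collect_finite_All)
      fix l assume "l \<in> {..<n}"
      then show "{\<omega> \<in> space M. Nk (S (\<tau> (Suc l)) \<omega>) \<omega> = Nk (S (\<tau> l) \<omega>) \<omega> + j l} \<in> sets M"
        using \<tau>_nonneg by (intro sets_Collect_eq_add NkS_measurable) auto
    qed (use Ypath_sets[OF B] in auto)
    finally show "?A \<in> sets M" .
    show "{\<omega> \<in> space M. ((Npath \<omega>, Ypath \<omega>), Spath \<omega>) \<in> ?E} \<in> sets M"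
      by (rule sets_Collect_vimage[OF measurable_Pair[OF path Spath_measurable] E])
  qed
  also have "\<dots> = (\<integral>\<^sup>+\<omega>. emeasure M {\<omega>' \<in> space M. ((Npath \<omega>', Ypath \<omega>'), Spath \<omega>) \<in> ?E} \<partial>M)"
    by (rule indep_elements_emeasure[OF indep_S E])
  also have "\<dots> = (\<integral>\<^sup>+\<omega>. (\<Prod>l<n. Nk_prob (j l) (S (\<tau> (Suc l)) \<omega> - S (\<tau> l) \<omega>)) *
      emeasure M {\<omega> \<in> space M. Ypath \<omega> \<in> B} \<partial>M)"
  proof (rule nn_integral_cong_AE, use levy_subordinator_AE[OF S] in eventually_elim)
    fix \<omega> assume \<omega>: "S 0 \<omega> = 0 \<and> mono_on {0..} (\<lambda>t. S t \<omega>)"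
    have s: "0 \<le> S (\<tau> 0) \<omega>" "\<And>l. l < n \<Longrightarrow> S (\<tau> l) \<omega> \<le> S (\<tau> (Suc l)) \<omega>"
      using \<omega> S_nonneg[OF \<omega>, of 0] \<tau>(2) \<tau>_nonneg by (auto simp: mono_on_def)
    have "emeasure M {\<omega>' \<in> space M. ((Npath \<omega>', Ypath \<omega>'), Spath \<omega>) \<in> ?E} =
        emeasure M {\<omega>' \<in> space M. (\<forall>l<n. Nk (S (\<tau> (Suc l)) \<omega>) \<omega>' = Nk (S (\<tau> l) \<omega>) \<omega>' + j l) \<and> Ypath \<omega>' \<in> B}"
    proof (rule emeasure_Collect_cong_AE)
      show "AE \<omega>' in M. ((Npath \<omega>', Ypath \<omega>'), Spath \<omega>) \<in> ?E \<longleftrightarrow>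
          ((\<forall>l<n. Nk (S (\<tau> (Suc l)) \<omega>) \<omega>' = Nk (S (\<tau> l) \<omega>) \<omega>' + j l) \<and> Ypath \<omega>' \<in> B)"
        using Nk_right_continuous
      proof eventually_elim
        case (elim \<omega>')
        show ?case unfolding E_iff[OF \<omega> elim] ..
      qed
      show "{\<omega>' \<in> space M. ((Npath \<omega>', Ypath \<omega>'), Spath \<omega>) \<in> ?E} \<in> sets M"
        by (rule sets_Collect_vimage[OF measurable_Pair[OF path measurable_const] E])
          (simp add: space_PiM)
      have "{\<omega>' \<in> space M. (\<forall>l<n. Nk (S (\<tau> (Suc l)) \<omega>) \<omega>' = Nk (S (\<tau> l) \<omega>) \<omega>' + j l) \<and> Ypath \<omega>' \<in> B} =
          {\<omega>' \<in> space M. \<forall>l<n. Nk (S (\<tau> (Suc l)) \<omega>) \<omega>' = Nk (S (\<tau> l) \<omega>) \<omega>' + j l} \<inter>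
          {\<omega>' \<in> space M. Ypath \<omega>' \<in> B}" by auto
      also have "\<dots> \<in> sets M"
        using sets_increments[of "\<lambda>l. S (\<tau> l) \<omega>", OF s] Ypath_sets[OF B] by (intro sets.Int)
      finally show "{\<omega>' \<in> space M. (\<forall>l<n. Nk (S (\<tau> (Suc l)) \<omega>) \<omega>' = Nk (S (\<tau> l) \<omega>) \<omega>' + j l) \<and>
        Ypath \<omega>' \<in> B} \<in> sets M" .
    qed
    then show "emeasure M {\<omega>' \<in> space M. ((Npath \<omega>', Ypath \<omega>'), Spath \<omega>) \<in> ?E} =
        (\<Prod>l<n. Nk_prob (j l) (S (\<tau> (Suc l)) \<omega> - S (\<tau> l) \<omega>)) * emeasure M {\<omega> \<in> space M. Ypath \<omega> \<in> B}"
      using emeasure_increments_Y[of "\<lambda>l. S (\<tau> l) \<omega>", OF s B] by simp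
  qed
  also have "\<dots> = (\<integral>\<^sup>+\<omega>. (\<Prod>l<n. Nk_prob (j l) (S (\<tau> (Suc l)) \<omega> - S (\<tau> l) \<omega>)) \<partial>M) *
      emeasure M {\<omega> \<in> space M. Ypath \<omega> \<in> B}"
  proof (rule nn_integral_multc, rule borel_measurable_prod_ennreal)
    fix l assume "l \<in> {..<n}"
    then have [measurable]: "S (\<tau> l) \<in> borel_measurable M" "S (\<tau> (Suc l)) \<in> borel_measurable M"
      using S \<tau>_nonneg by (auto simp: levy_subordinator_def levy_process_def)
    show "(\<lambda>\<omega>. Nk_prob (j l) (S (\<tau> (Suc l)) \<omega> - S (\<tau> l) \<omega>)) \<in> borel_measurable M"
      by measurable
  qed
  finally show ?thesis .
qed

text \<open>One step of the mixture, over the times 0 and \<open>u\<close> and with no constraint on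
  \<open>Y\<close>. The initial value \<open>Nk (S 0)\<close> disappears because both processes
  start at 0 almost surely.\<close>

lemma nn_integral_Nk_prob:
  assumes u: "0 \<le> u"
  shows "(\<integral>\<^sup>+\<omega>. Nk_prob i (S u \<omega>) \<partial>M) = emeasure M {\<omega> \<in> space M. Nk (S u \<omega>) \<omega> = i}"
proof -
  have "(\<lambda>\<omega>. Nk (S u \<omega>) \<omega>) \<in> measurable M (count_space UNIV)"
    "(\<lambda>\<omega>. Nk (S 0 \<omega>) \<omega>) \<in> measurable M (count_space UNIV)"
    using u by (auto intro: NkS_measurable)
  have "space Yspace \<in> sets Yspace" by simp
  from emeasure_subordinated_mixture[of "\<lambda>l. if l = 0 then 0 else u" 1, OF _ _ this, of "\<lambda>_. i"] u
  have "emeasure M {\<omega> \<in> space M. Nk (S u \<omega>) \<omega> = Nk (S 0 \<omega>) \<omega> + i} =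
      (\<integral>\<^sup>+\<omega>. Nk_prob i (S u \<omega> - S 0 \<omega>) \<partial>M)"
    by (simp add: space_PiM emeasure_space_1)
  also have "\<dots> = (\<integral>\<^sup>+\<omega>. Nk_prob i (S u \<omega>) \<partial>M)"
    using levy_subordinator_AE[OF S] by (intro nn_integral_cong_AE) (auto elim: eventually_mono)
  also have "emeasure M {\<omega> \<in> space M. Nk (S u \<omega>) \<omega> = Nk (S 0 \<omega>) \<omega> + i} =
      emeasure M {\<omega> \<in> space M. Nk (S u \<omega>) \<omega> = i}"
  proof (rule emeasure_Collect_cong_AE)
    show "AE \<omega> in M. Nk (S u \<omega>) \<omega> = Nk (S 0 \<omega>) \<omega> + i \<longleftrightarrow> Nk (S u \<omega>) \<omega> = i"
      using levy_subordinator_AE[OF S] PPoK_paths[OF Nk] by eventually_elim auto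
    show "{\<omega> \<in> space M. Nk (S u \<omega>) \<omega> = Nk (S 0 \<omega>) \<omega> + i} \<in> sets M"
      by (rule sets_Collect_eq_add) fact+
    have "(\<lambda>\<omega>. Nk (S u \<omega>) \<omega>) \<in> measurable M (count_space UNIV)" by fact
    from sets_Collect_vimage[OF this, of "{i}"]
    show "{\<omega> \<in> space M. Nk (S u \<omega>) \<omega> = i} \<in> sets M" by simp
  qed
  finally show ?thesis ..
qed

text \<open>Here the increments of \<open>S\<close> enter; until this point \<open>S\<close>
  contributed only its path properties and its independence of \<open>(Nk, Y)\<close>.\<close>

lemma emeasure_subordinated_increments:
  assumes \<tau>: "0 \<le> \<tau> 0" "\<And>l. l < n \<Longrightarrow> \<tau> l \<le> \<tau> (Suc l)" and B: "B \<in> sets Yspace"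
  shows "emeasure M {\<omega> \<in> space M.
      (\<forall>l<n. Nk (S (\<tau> (Suc l)) \<omega>) \<omega> = Nk (S (\<tau> l) \<omega>) \<omega> + j l) \<and> Ypath \<omega> \<in> B} =
    (\<Prod>l<n. emeasure M {\<omega> \<in> space M. Nk (S (\<tau> (Suc l) - \<tau> l) \<omega>) \<omega> = j l}) *
      emeasure M {\<omega> \<in> space M. Ypath \<omega> \<in> B}"
proof -
  have "(\<integral>\<^sup>+\<omega>. (\<Prod>l<n. Nk_prob (j l) (S (\<tau> (Suc l)) \<omega> - S (\<tau> l) \<omega>)) \<partial>M) =
      (\<Prod>l<n. \<integral>\<^sup>+\<omega>. Nk_prob (j l) (S (\<tau> (Suc l) - \<tau> l) \<omega>) \<partial>M)"
    using S \<tau> by (intro nn_integral_prod_increments)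
      (auto simp: levy_subordinator_def levy_process_def)
  also have "\<dots> = (\<Prod>l<n. emeasure M {\<omega> \<in> space M. Nk (S (\<tau> (Suc l) - \<tau> l) \<omega>) \<omega> = j l})"
    using \<tau> by (intro prod.cong nn_integral_Nk_prob) auto
  finally show ?thesis
    by (simp only: emeasure_subordinated_mixture[of \<tau>, OF \<tau>(1) \<tau>(2) B])
qed

end

section \<open>Finite-dimensional distributions\<close>

text \<open>The index set of the theorem consists of functions and \<open>has_sum\<close> is
  unordered. Countable additivity is therefore transported along an enumeration, and nonnegativity
  makes the ordered and the unordered sum agree.\<close>

lemma (in finite_measure) has_sum_measure_UN:
  assumes "countable I" and sets: "\<And>i. i \<in> I \<Longrightarrow> A i \<in> sets M" and disj: "disjoint_family_on A I"
  shows "((\<lambda>i. measure M (A i)) has_sum measure M (\<Union>i\<in>I. A i)) I"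
proof -
  \<comment> \<open>A finite \<open>I\<close> leaves numbers without an index; they receive the
    empty set.\<close>
  define B where "B n = (if n \<in> to_nat_on I ` I then A (from_nat_into I n) else {})" for n
  have B_to_nat: "B (to_nat_on I i) = A i" if "i \<in> I" for i
    using that \<open>countable I\<close> by (simp add: B_def)
  have B_empty: "B n = {}" if "n \<notin> to_nat_on I ` I" for n
    using that by (simp add: B_def)
  have "range B \<subseteq> sets M"
    using sets B_to_nat by (auto simp: B_def)
  moreover have "disjoint_family B"
    unfolding disjoint_family_on_def
  proof safe
    fix m n x assume "m \<noteq> n" and x: "x \<in> B m" "x \<in> B n"
    then obtain i i' where i: "i \<in> I" "m = to_nat_on I i" "i' \<in> I" "n = to_nat_on I i'"
      using B_empty by blast
    then have "x \<in> A i \<inter> A i'" using x B_to_nat by auto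
    moreover have "i \<noteq> i'" using i \<open>m \<noteq> n\<close> by auto
    ultimately show "x \<in> {}" using i disj by (auto simp: disjoint_family_on_def)
  qed
  ultimately have "(\<lambda>n. measure M (B n)) sums measure M (\<Union>n. B n)"
    by (rule finite_measure_UNION)
  moreover have "(\<Union>n. B n) = (\<Union>i\<in>I. A i)"
  proof (intro equalityI subsetI)
    fix x assume "x \<in> (\<Union>n. B n)"
    then obtain n where n: "x \<in> B n" by blast
    then obtain i where "i \<in> I" "n = to_nat_on I i" using B_empty by blast
    then show "x \<in> (\<Union>i\<in>I. A i)" using n B_to_nat by auto
  next
    fix x assume "x \<in> (\<Union>i\<in>I. A i)"
    then obtain i where "i \<in> I" "x \<in> A i" by blast
    then show "x \<in> (\<Union>n. B n)" using B_to_nat[of i] by blast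
  qed
  ultimately have "((\<lambda>n. measure M (B n)) has_sum measure M (\<Union>i\<in>I. A i)) UNIV"
    by (intro sums_nonneg_imp_has_sum) auto
  then have "((\<lambda>n. measure M (B n)) has_sum measure M (\<Union>i\<in>I. A i)) (to_nat_on I ` I)"
    by (rule has_sum_cong_neutral[THEN iffD1, rotated -1]) (auto simp: B_empty)
  then have "((\<lambda>n. measure M (B n)) \<circ> to_nat_on I has_sum measure M (\<Union>i\<in>I. A i)) I"
    using \<open>countable I\<close> by (subst (asm) has_sum_reindex) (auto intro: inj_on_to_nat_on)
  then show ?thesis
    by (rule has_sum_cong[THEN iffD1, rotated]) (simp add: B_to_nat)
qed

text \<open>The product measure behind the iterated integral is the joint law of the block sums,
  whose partial sums run over all indices up to the end of a block. The family \<open>x\<close> is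
  arbitrary because the full integral has no frozen coordinates.\<close>

lemma (in prob_space) prob_partial_sums:
  fixes X :: "nat \<Rightarrow> 'a \<Rightarrow> real" and y :: "nat \<Rightarrow> real" and j :: "nat \<Rightarrow> nat"
  assumes ind: "indep_vars (\<lambda>_. borel) X {1..}" and law: "\<And>i. 1 \<le> i \<Longrightarrow> distr M borel (X i) = \<mu>"
    and \<mu>: "prob_space \<mu>" "sets \<mu> = sets borel" and "1 \<le> n"
  shows "prob {\<omega> \<in> space M. \<forall>l\<in>{1..n}. (\<Sum>i\<in>{0<..\<Sum>m=1..l. j m}. X i \<omega>) \<le> y l} =
    iterated_integral (\<lambda>m. walk_law \<mu> (j m)) y n 1 x"
proof -
  define a where "a m = (\<Sum>i=1..m. j i)" for m
  have a_mono: "a m \<le> a m'" if "m \<le> m'" for m m'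
    using that unfolding a_def by (intro sum_mono2) auto
  have a_step: "a m = a (m - 1) + j m" if "1 \<le> m" for m
    using that by (cases m) (simp_all add: a_def)
  define K where "K m = {a (m - 1)<..a m}" for m
  define V where "V m \<omega> = (\<Sum>i\<in>K m. X i \<omega>)" for m \<omega>
  have rv: "X i \<in> borel_measurable M" if "1 \<le> i" for i
    using ind that by (auto simp: indep_vars_def)
  have V_rv: "V m \<in> borel_measurable M" for m
    unfolding V_def[abs_def] K_def by (intro borel_measurable_sum rv) auto
  have disj: "disjoint_family_on K {1..n}"
  proof -
    have "K m \<inter> K m' = {}" if "m < m'" for m m'
    proof -
      have "a m \<le> a (m' - 1)" using that by (intro a_mono) simp
      then show ?thesis by (auto simp: K_def)
    qed
    then show ?thesis
      unfolding disjoint_family_on_def by (metis Int_commute linorder_neqE_nat)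
  qed
  have sum_V: "(\<Sum>m=1..l. V m \<omega>) = (\<Sum>i\<in>{0<..a l}. X i \<omega>)" for l \<omega>
  proof (induction l)
    case 0
    then show ?case by (simp add: a_def)
  next
    case (Suc l)
    have "{0<..a (Suc l)} = {0<..a l} \<union> K (Suc l)" "{0<..a l} \<inter> K (Suc l) = {}"
      using a_mono[of l "Suc l"] by (auto simp: K_def)
    then have "(\<Sum>i\<in>{0<..a (Suc l)}. X i \<omega>) = (\<Sum>i\<in>{0<..a l}. X i \<omega>) + V (Suc l) \<omega>"
      unfolding V_def by (simp only:) (intro sum.union_disjoint, auto simp: K_def)
    then show ?case using Suc by simp
  qed
  have V_law: "distr M borel (V m) = walk_law \<mu> (j m)" if "m \<in> {1..n}" for m
  proof -
    have "K m = {a (m - 1)<..a (m - 1) + j m}"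
      using a_step[of m] that by (simp add: K_def)
    then show ?thesis
      unfolding V_def[abs_def] using distr_sum_iid[OF ind law, where a = "a (m - 1)" and d = "j m"] by simp
  qed
  have "indep_vars (\<lambda>_. borel) V {1..n}"
    unfolding V_def[abs_def]
    by (rule indep_vars_block_sums[OF ind _ disj]) (auto simp: K_def)
  \<comment> \<open>\<open>1 \<le> n\<close> makes the index set nonempty, as required for
    expressing independence by a product law.\<close>
  then have "distr M (PiM {1..n} (\<lambda>_. borel)) (\<lambda>\<omega>. \<lambda>m\<in>{1..n}. V m \<omega>) =
      PiM {1..n} (\<lambda>m. distr M borel (V m))"
    using \<open>1 \<le> n\<close> V_rv by (subst (asm) indep_vars_iff_distr_eq_PiM) auto
  also have "\<dots> = PiM {1..n} (\<lambda>m. walk_law \<mu> (j m))"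
    by (rule PiM_cong) (simp_all only: V_law)
  finally have joint: "distr M (PiM {1..n} (\<lambda>_. borel)) (\<lambda>\<omega>. \<lambda>m\<in>{1..n}. V m \<omega>) =
      PiM {1..n} (\<lambda>m. walk_law \<mu> (j m))" .
  let ?D = "PiM {1..n} (\<lambda>_. borel) :: (nat \<Rightarrow> real) measure"
  let ?E = "{z \<in> space ?D. \<forall>l\<in>{1..n}. (\<Sum>i=1..l. z i) \<le> y l}"
  have E: "?E \<in> sets ?D"
  proof (rule sets.sets_Collect_finite_All)
    fix l assume "l \<in> {1..n}"
    then have "(\<lambda>z. \<Sum>i=1..l. z i) \<in> borel_measurable ?D"
      by (intro borel_measurable_sum measurable_component_singleton) auto
    then show "{z \<in> space ?D. (\<Sum>i=1..l. z i) \<le> y l} \<in> sets ?D"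
      by (rule borel_measurable_le) simp
  qed simp
  have space: "space (PiM {1..n} (\<lambda>m. walk_law \<mu> (j m))) = space ?D"
    unfolding joint[symmetric] by simp
  have V_path: "(\<lambda>\<omega>. \<lambda>m\<in>{1..n}. V m \<omega>) \<in> measurable M ?D"
    by (rule measurable_restrict) (rule V_rv)
  have "iterated_integral (\<lambda>m. walk_law \<mu> (j m)) y n 1 x =
      measure (PiM {1..n} (\<lambda>m. walk_law \<mu> (j m))) ?E"
    using iterated_integral_eq_measure[of "\<lambda>m. walk_law \<mu> (j m)" 1 y n x]
      prob_space_walk_law[OF \<mu>] space
    by (simp add: atLeastLessThanSuc_atLeastAtMost)
  also have "\<dots> = prob {\<omega> \<in> space M. (\<lambda>m\<in>{1..n}. V m \<omega>) \<in> ?E}"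
    unfolding joint[symmetric] measure_distr[OF V_path E]
    by (rule arg_cong[where f = prob]) blast
  also have "{\<omega> \<in> space M. (\<lambda>m\<in>{1..n}. V m \<omega>) \<in> ?E} =
      {\<omega> \<in> space M. \<forall>l\<in>{1..n}. (\<Sum>m=1..l. V m \<omega>) \<le> y l}"
  proof -
    have "(\<lambda>m\<in>{1..n}. V m \<omega>) \<in> ?E \<longleftrightarrow> (\<forall>l\<in>{1..n}. (\<Sum>m=1..l. V m \<omega>) \<le> y l)" for \<omega>
    proof -
      have "(\<Sum>i=1..l. (\<lambda>m\<in>{1..n}. V m \<omega>) i) = (\<Sum>m=1..l. V m \<omega>)" if "l \<in> {1..n}" for l
        using that by (intro sum.cong) auto
      moreover have "(\<lambda>m\<in>{1..n}. V m \<omega>) \<in> space ?D"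
        by (simp add: space_PiM)
      ultimately show ?thesis by simp
    qed
    then show ?thesis by blast
  qed
  finally show ?thesis
    unfolding sum_V a_def ..
qed

theorem theorem3p1:
  fixes M :: "'a measure" and k n :: nat
    and lam c\<^sub>1 c\<^sub>2 \<alpha>\<^sub>1 \<alpha>\<^sub>2 \<mu>\<^sub>1 \<mu>\<^sub>2 :: real
    and H h :: "real \<Rightarrow> real"
    and Nk :: "real \<Rightarrow> 'a \<Rightarrow> nat" and Y :: "nat \<Rightarrow> 'a \<Rightarrow> real"
    and Z S Z1 :: "real \<Rightarrow> 'a \<Rightarrow> real"
    and t y :: "nat \<Rightarrow> real" and q :: "nat \<Rightarrow> real \<Rightarrow> real"
  assumes "prob_space M"
    and "k \<ge> 1" and "lam > 0"
    and "c\<^sub>1 \<ge> 0" and "c\<^sub>2 \<ge> 0" and "c\<^sub>1 + c\<^sub>2 = 1"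
    and "\<mu>\<^sub>1 > 0" and "\<mu>\<^sub>2 > 0"
    and "\<alpha>\<^sub>1 \<in> {0<..<1}" and "\<alpha>\<^sub>2 \<in> {0<..<1}"
    and "TCPPoK M k lam H c\<^sub>1 c\<^sub>2 \<alpha>\<^sub>1 \<alpha>\<^sub>2 \<mu>\<^sub>1 \<mu>\<^sub>2 Nk Y Z S Z1"
    and "has_density H h"
    and "n \<ge> 1" and "t 0 = 0" and "\<forall>l\<in>{1..n}. t (l - 1) \<le> t l"
    and "\<And>j u. u \<ge> 0 \<Longrightarrow> q j u = measure M {\<omega> \<in> space M. Nk (S u \<omega>) \<omega> = j}"
  shows "((\<lambda>j. (\<Prod>l=1..n. q (j l) (t l - t (l - 1))) *
               iterated_integral (\<lambda>m. convolution_law h (j m)) y n 1 (\<lambda>_. 0))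
          has_sum measure M {\<omega> \<in> space M. \<forall>l\<in>{1..n}. Z1 (t l) \<omega> \<le> y l})
         ({1..n} \<rightarrow>\<^sub>E (UNIV :: nat set))"
proof -
  interpret prob_space M by fact
  note TC = \<open>TCPPoK M k lam H c\<^sub>1 c\<^sub>2 \<alpha>\<^sub>1 \<alpha>\<^sub>2 \<mu>\<^sub>1 \<mu>\<^sub>2 Nk Y Z S Z1\<close>
  note CP = TC[unfolded TCPPoK_def, THEN conjunct1]
  interpret random_time_change M k lam Nk Y S
  proof
    show "PPoK M k lam Nk"
      and "indep_elements M (PiM {0..} (\<lambda>_. count_space UNIV)) (\<lambda>\<omega>. \<lambda>t\<in>{0..}. Nk t \<omega>)
        (PiM {1..} (\<lambda>_. borel)) (\<lambda>\<omega>. \<lambda>i\<in>{1..}. Y i \<omega>)"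
      using CP unfolding CPPoK_def by blast+
    show "levy_subordinator M S"
      and "indep_elements M (PiM {0..} (\<lambda>_. count_space UNIV) \<Otimes>\<^sub>M PiM {1..} (\<lambda>_. borel))
        (\<lambda>\<omega>. (\<lambda>t\<in>{0..}. Nk t \<omega>, \<lambda>i\<in>{1..}. Y i \<omega>)) (PiM {0..} (\<lambda>_. borel)) (\<lambda>\<omega>. \<lambda>t\<in>{0..}. S t \<omega>)"
      and "0 \<le> s \<Longrightarrow> (\<lambda>\<omega>. Nk (S s \<omega>) \<omega>) \<in> measurable M (count_space UNIV)" for s
      using TC unfolding TCPPoK_def MTSS_def by blast+
  qed
  have Z: "Z s \<omega> = (\<Sum>i=1..Nk s \<omega>. Y i \<omega>)" if "0 \<le> s" "\<omega> \<in> space M" for s \<omega>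
    using CP that unfolding CPPoK_def by blast
  have Z1: "Z1 s \<omega> = Z (S s \<omega>) \<omega>" if "0 \<le> s" "\<omega> \<in> space M" for s \<omega>
    using TC that unfolding TCPPoK_def by blast
  have Z1_rv: "Z1 s \<in> borel_measurable M" if "0 \<le> s" for s
    using TC that unfolding TCPPoK_def by blast
  have Y_ind: "indep_vars (\<lambda>_. borel) Y {1..}"
    using CP unfolding CPPoK_def by blast
  define \<mu> where "\<mu> = density lborel (\<lambda>x. ennreal (h x))"
  have Y_law: "distr M borel (Y i) = \<mu>" if "1 \<le> i" for i
    unfolding \<mu>_def
  proof (rule has_density_law[OF \<open>has_density H h\<close>])
    have "Y i \<in> borel_measurable M"
      using Y_ind that by (auto simp: indep_vars_def)
    then show "prob_space (distr M borel (Y i))"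
      by (rule prob_space_distr)
    show "cdf (distr M borel (Y i)) = H"
      using CP that unfolding CPPoK_def by blast
  qed simp
  have "Y 1 \<in> borel_measurable M"
    using Y_ind by (auto simp: indep_vars_def)
  then have "prob_space (distr M borel (Y 1))"
    by (rule prob_space_distr)
  then have \<mu>_prob: "prob_space \<mu>"
    by (simp only: Y_law[OF order_refl])
  have \<mu>_sets: "sets \<mu> = sets borel"
    by (simp add: \<mu>_def)
  have conv: "convolution_law h i = walk_law \<mu> i" for i
    using \<mu>_prob \<open>has_density H h\<close> unfolding \<mu>_def has_density_def
    by (intro convolution_law_eq_walk_law) auto
  have t_step: "t l \<le> t (Suc l)" if "l < n" for l
    using bspec[OF \<open>\<forall>l\<in>{1..n}. t (l - 1) \<le> t l\<close>, of "Suc l"] that by simp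
  have t_nonneg: "0 \<le> t l" if "l \<le> n" for l
    using mono_of_steps[of n t 0 l, OF t_step] \<open>t 0 = 0\<close> that by simp
  \<comment> \<open>A set of sequences only: with j fixed, the number of summands at the l-th time
    is the constant j_1 + ... + j_l.\<close>
  define B where "B j = {x \<in> space Yspace. \<forall>l\<in>{1..n}. (\<Sum>i\<in>{0<..\<Sum>m=1..l. j m}. x i) \<le> y l}"
    for j :: "nat \<Rightarrow> nat"
  have B_sets: "B j \<in> sets Yspace" for j
    unfolding B_def
  proof (rule sets.sets_Collect_finite_All)
    fix l
    have "(\<lambda>x. \<Sum>i\<in>{0<..\<Sum>m=1..l. j m}. x i) \<in> borel_measurable Yspace"
      by (intro borel_measurable_sum measurable_component_singleton) auto
    then show "{x \<in> space Yspace. (\<Sum>i\<in>{0<..\<Sum>m=1..l. j m}. x i) \<le> y l} \<in> sets Yspace"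
      by (rule borel_measurable_le) simp
  qed simp
  have Ypath_B: "Ypath \<omega> \<in> B j \<longleftrightarrow> (\<forall>l\<in>{1..n}. (\<Sum>i\<in>{0<..\<Sum>m=1..l. j m}. Y i \<omega>) \<le> y l)" for j \<omega>
  proof -
    have "(\<Sum>i\<in>{0<..c}. Ypath \<omega> i) = (\<Sum>i\<in>{0<..c}. Y i \<omega>)" for c
      by (intro sum.cong) auto
    moreover have "Ypath \<omega> \<in> space Yspace"
      by (simp add: space_PiM)
    ultimately show ?thesis by (simp add: B_def)
  qed
  define W where "W l \<omega> = Nk (S (t l) \<omega>) \<omega>" for l \<omega>
  have W_rv: "W l \<in> measurable M (count_space UNIV)" if "l \<le> n" for l
    unfolding W_def[abs_def] by (intro NkS_measurable t_nonneg that)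
  \<comment> \<open>Steps are counted from 0 and the entries of \<open>j\<close> from 1, hence
    \<open>j (Suc l)\<close>.\<close>
  define A where "A j = {\<omega> \<in> space M. (\<forall>l<n. W (Suc l) \<omega> = W l \<omega> + j (Suc l)) \<and> Ypath \<omega> \<in> B j}" for j
  have A_sets: "A j \<in> sets M" for j
  proof -
    have "{\<omega> \<in> space M. \<forall>l\<in>{..<n}. W (Suc l) \<omega> = W l \<omega> + j (Suc l)} \<in> sets M"
    proof (rule sets.sets_Collect_finite_All)
      fix l assume "l \<in> {..<n}"
      then have "Suc l \<le> n" "l \<le> n" by auto
      then show "{\<omega> \<in> space M. W (Suc l) \<omega> = W l \<omega> + j (Suc l)} \<in> sets M"
        by (rule sets_Collect_eq_add[OF W_rv W_rv])
    qed (rule finite_lessThan)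
    then have "{\<omega> \<in> space M. \<forall>l<n. W (Suc l) \<omega> = W l \<omega> + j (Suc l)} \<in> sets M"
      unfolding Ball_def lessThan_iff .
    then have "{\<omega> \<in> space M. \<forall>l<n. W (Suc l) \<omega> = W l \<omega> + j (Suc l)} \<inter> {\<omega> \<in> space M. Ypath \<omega> \<in> B j} \<in> sets M"
      using Ypath_sets[OF B_sets] by (rule sets.Int)
    moreover have "A j = {\<omega> \<in> space M. \<forall>l<n. W (Suc l) \<omega> = W l \<omega> + j (Suc l)} \<inter> {\<omega> \<in> space M. Ypath \<omega> \<in> B j}"
      unfolding A_def by blast
    ultimately show ?thesis by (simp only:)
  qed
  have prob_A: "prob (A j) = (\<Prod>l=1..n. q (j l) (t l - t (l - 1))) *
      iterated_integral (\<lambda>m. convolution_law h (j m)) y n 1 (\<lambda>_. 0)" for j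
  proof -
    have "emeasure M (A j) = (\<Prod>l<n. emeasure M {\<omega> \<in> space M. Nk (S (t (Suc l) - t l) \<omega>) \<omega> = j (Suc l)}) *
        emeasure M {\<omega> \<in> space M. Ypath \<omega> \<in> B j}"
      unfolding A_def W_def
      by (rule emeasure_subordinated_increments[of t, OF t_nonneg[OF le0] t_step B_sets])
    also have "\<dots> = ennreal ((\<Prod>l<n. prob {\<omega> \<in> space M. Nk (S (t (Suc l) - t l) \<omega>) \<omega> = j (Suc l)}) *
        prob {\<omega> \<in> space M. Ypath \<omega> \<in> B j})"
      by (simp add: emeasure_eq_measure prod_ennreal ennreal_mult prod_nonneg)
    finally have "prob (A j) = (\<Prod>l<n. prob {\<omega> \<in> space M. Nk (S (t (Suc l) - t l) \<omega>) \<omega> = j (Suc l)}) *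
        prob {\<omega> \<in> space M. Ypath \<omega> \<in> B j}"
      by (simp add: measure_def prod_nonneg)
    also have "(\<Prod>l<n. prob {\<omega> \<in> space M. Nk (S (t (Suc l) - t l) \<omega>) \<omega> = j (Suc l)}) =
        (\<Prod>l=1..n. q (j l) (t l - t (l - 1)))"
      unfolding One_nat_def prod.atLeast1_atMost_eq
      by (rule prod.cong) (simp_all add: assms(16) t_step)
    also have "prob {\<omega> \<in> space M. Ypath \<omega> \<in> B j} =
        iterated_integral (\<lambda>m. convolution_law h (j m)) y n 1 (\<lambda>_. 0)"
      unfolding Ypath_B conv
      by (rule prob_partial_sums[OF Y_ind Y_law \<mu>_prob \<mu>_sets \<open>n \<ge> 1\<close>])
    finally show ?thesis .
  qed
  let ?I = "{1..n} \<rightarrow>\<^sub>E (UNIV :: nat set)"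
  \<comment> \<open>The increments of \<open>W\<close> recover \<open>j\<close> on
    \<open>{1..n}\<close>, and extensionality fixes it elsewhere.\<close>
  have "disjoint_family_on A ?I"
    unfolding disjoint_family_on_def
  proof safe
    fix j j' \<omega> assume j: "j \<in> ?I" "j' \<in> ?I" "j \<noteq> j'" and \<omega>: "\<omega> \<in> A j" "\<omega> \<in> A j'"
    have "j l = j' l" if "l \<in> {1..n}" for l
    proof -
      define l' where "l' = l - 1"
      then have l': "l = Suc l'" "l' < n" using that by auto
      have "W (Suc l') \<omega> = W l' \<omega> + j (Suc l')" "W (Suc l') \<omega> = W l' \<omega> + j' (Suc l')"
        using \<omega> l'(2) by (simp_all add: A_def)
      then show ?thesis using l' by simp
    qed
    then have "j = j'" using j(1,2) by (intro PiE_ext)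
    then show "\<omega> \<in> {}" using j(3) by simp
  qed
  then have "((\<lambda>j. prob (A j)) has_sum prob (\<Union>j\<in>?I. A j)) ?I"
    by (intro has_sum_measure_UN A_sets countable_PiE) auto
  \<comment> \<open>The two events agree only almost surely: on a path where \<open>W\<close>
    decreases, no vector of natural increments exists.\<close>
  moreover have "prob (\<Union>j\<in>?I. A j) = prob {\<omega> \<in> space M. \<forall>l\<in>{1..n}. Z1 (t l) \<omega> \<le> y l}"
  proof (rule finite_measure_eq_AE)
    have "countable ?I" by (intro countable_PiE) auto
    then show "(\<Union>j\<in>?I. A j) \<in> sets M"
      using A_sets by (intro sets.countable_UN') auto
    show "{\<omega> \<in> space M. \<forall>l\<in>{1..n}. Z1 (t l) \<omega> \<le> y l} \<in> sets M"
    proof (rule sets.sets_Collect_finite_All)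
      fix l assume "l \<in> {1..n}"
      then show "{\<omega> \<in> space M. Z1 (t l) \<omega> \<le> y l} \<in> sets M"
        by (intro borel_measurable_le Z1_rv t_nonneg) auto
    qed simp
    show "AE \<omega> in M. \<omega> \<in> (\<Union>j\<in>?I. A j) \<longleftrightarrow> \<omega> \<in> {\<omega> \<in> space M. \<forall>l\<in>{1..n}. Z1 (t l) \<omega> \<le> y l}"
      using levy_subordinator_AE[OF S] PPoK_paths[OF Nk] AE_space
    proof eventually_elim
      case (elim \<omega>)
      have S_mono: "S (t l) \<omega> \<le> S (t l') \<omega>" if "l \<le> l'" "l' \<le> n" for l l'
        using elim(1) t_nonneg[of l] t_nonneg[of l'] mono_of_steps[of n t l l', OF t_step] that
          mono_onD[of "{0..}" "\<lambda>s. S s \<omega>" "t l" "t l'"] by simp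
      have S_nonneg: "0 \<le> S (t l) \<omega>" if "l \<le> n" for l
        using S_mono[of 0 l] that elim(1) \<open>t 0 = 0\<close> by simp
      have W_mono: "W l \<omega> \<le> W (Suc l) \<omega>" if "l < n" for l
        using elim(2) S_nonneg[of l] S_nonneg[of "Suc l"] S_mono[of l "Suc l"] that
          mono_onD[of "{0..}" "\<lambda>s. Nk s \<omega>" "S (t l) \<omega>" "S (t (Suc l)) \<omega>"] by (simp add: W_def)
      have W_0: "W 0 \<omega> = 0"
        using elim(1,2) \<open>t 0 = 0\<close> by (simp add: W_def)
      have Z1_eq: "Z1 (t l) \<omega> = (\<Sum>i\<in>{0<..W l \<omega>}. Y i \<omega>)" if "l \<le> n" for l
        using t_nonneg[OF that] S_nonneg[OF that] elim(3)
        by (simp add: Z1 Z W_def atLeastSucAtMost_greaterThanAtMost)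
      have W_sum: "W l \<omega> = (\<Sum>m=1..l. j m)" if "\<forall>l<n. W (Suc l) \<omega> = W l \<omega> + j (Suc l)" "l \<le> n" for j l
        using that(2) by (induction l) (simp_all add: W_0 that(1))
      have A_iff: "\<omega> \<in> A j \<longleftrightarrow> (\<forall>l<n. W (Suc l) \<omega> = W l \<omega> + j (Suc l)) \<and>
          (\<forall>l\<in>{1..n}. Z1 (t l) \<omega> \<le> y l)" for j
      proof (cases "\<forall>l<n. W (Suc l) \<omega> = W l \<omega> + j (Suc l)")
        case True
        have "Ypath \<omega> \<in> B j \<longleftrightarrow> (\<forall>l\<in>{1..n}. Z1 (t l) \<omega> \<le> y l)"
          unfolding Ypath_B
          by (rule ball_cong) (simp_all add: Z1_eq W_sum[OF True])
        then show ?thesis using True elim(3) by (simp add: A_def)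
      next
        case False
        then show ?thesis unfolding A_def by blast
      qed
      \<comment> \<open>The witness is the vector of increments; by \<open>W_mono\<close> its
        subtraction does not truncate.\<close>
      have "\<exists>j\<in>?I. \<forall>l<n. W (Suc l) \<omega> = W l \<omega> + j (Suc l)"
        using W_mono by (intro bexI[of _ "\<lambda>l\<in>{1..n}. W l \<omega> - W (l - 1) \<omega>"]) auto
      then show ?case
        using A_iff elim(3) by blast
    qed
  qed
  ultimately show ?thesis
    by (simp only: prob_A)
qed

end
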